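(* Let $\Omega$ be a finite set of size $D\ge2$, let $k$ be an integer with $1\le k\le D-1$, and let $x_0\in\binom\Omega k$. For an integer $n\ge0$ write $Q(n)=\left\lfloor\frac12\binom{n}4+\frac14\binom{n}3-\frac18\binom{n}2+\frac1{16}\binom{n}1\right\rfloor$. Then: (i) if $1\le k<\frac D3$, $\dim\mathbf T(x_0)=\binom{k+3}4+Q(k+4)$; (ii) if $\frac D3\le k<\frac D2$, $\dim\mathbf T(x_0)=\binom{k+3}4+Q(k+4)-Q(3k-D+3)$; (iii) if $k=\frac D2$, $\dim\mathbf T(x_0)=Q(\frac D2+4)$; (iv) if $\frac D2<k\le\frac{2D}3$, $\dim\mathbf T(x_0)=\binom{D-k+3}4+Q(D-k+4)-Q(2D-3k+3)$; (v) if $\frac{2D}3<k\le D-1$, $\dim\mathbf T(x_0)=\binom{D-k+3}4+Q(D-k+4)$.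
   Context: $\binom\Omega k$ is the set of $k$-subsets of $\Omega$ and $\mathbb C^{\binom\Omega k}$ the vector space with that basis. The Johnson graph $J(D,k)$ has vertex set $\binom\Omega k$, with $x,y$ adjacent iff $|x\cap y|=k-1$. Its adjacency operator $\mathbf A$ on $\mathbb C^{\binom\Omega k}$ is $\mathbf Ax=\sum_{y\in\binom\Omega k,\,|x\cap y|=k-1}y$; the dual adjacency operator with respect to $x_0$ is $\mathbf A^*(x_0)x=(D-1)\left(1-\frac{D(|x_0\setminus x|+|x\setminus x_0|)}{2k(D-k)}\right)x$. The Terwilliger algebra $\mathbf T(x_0)$ is the subalgebra of $\mathrm{End}(\mathbb C^{\binom\Omega k})$ generated by $\mathbf A$ and $\mathbf A^*(x_0)$. $\binom n\ell=\prod_{i=1}^\ell\frac{n-i+1}{\ell-i+1}$ for $n,\ell\in\mathbb N$. *)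

theory Defs
  imports Complex_Main "HOL-Library.Function_Algebras" "HOL-Library.Ramsey"
begin

text \<open>
  The space \<open>\<complex>\<^bsup>X\<^esup>\<close> on a finite set \<open>X\<close> is the set of functions \<open>'b \<Rightarrow> complex\<close> that vanish
  outside \<open>X\<close>; the basis vector belonging to \<open>x\<close> is the indicator function of \<open>{x}\<close>.
\<close>

definition vscale :: "complex \<Rightarrow> ('b \<Rightarrow> complex) \<Rightarrow> 'b \<Rightarrow> complex"
  where "vscale c v = (\<lambda>x. c * v x)"

definition opscale ::
    "complex \<Rightarrow> (('b \<Rightarrow> complex) \<Rightarrow> 'b \<Rightarrow> complex) \<Rightarrow> ('b \<Rightarrow> complex) \<Rightarrow> 'b \<Rightarrow> complex"
  where "opscale c F = (\<lambda>v. vscale c (F v))"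

interpretation fvec: vector_space "vscale :: complex \<Rightarrow> ('b \<Rightarrow> complex) \<Rightarrow> _"
  by unfold_locales (auto simp: vscale_def fun_eq_iff algebra_simps)

interpretation oper: vector_space
    "opscale :: complex \<Rightarrow> (('b \<Rightarrow> complex) \<Rightarrow> 'b \<Rightarrow> complex) \<Rightarrow> _"
  by unfold_locales (auto simp: opscale_def vscale_def fun_eq_iff algebra_simps)

definition cspace :: "'b set \<Rightarrow> ('b \<Rightarrow> complex) set"
  where "cspace X = {v. \<forall>x. x \<notin> X \<longrightarrow> v x = 0}"

definition bvec :: "'b \<Rightarrow> 'b \<Rightarrow> complex"
  where "bvec x = (\<lambda>y. if y = x then 1 else 0)"

text \<open>
  A linear endomorphism of \<open>\<complex>\<^bsup>X\<^esup>\<close> is represented by its unique linear extension to all of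
  \<open>'b \<Rightarrow> complex\<close> that ignores the coordinates outside \<open>X\<close>. Sums, scalar multiples and
  compositions of such extensions are the extensions of the sums, scalar multiples and
  compositions; the identity of \<open>\<complex>\<^bsup>X\<^esup>\<close> is represented by the projection onto \<open>\<complex>\<^bsup>X\<^esup>\<close>.
\<close>

definition End_cspace :: "'b set \<Rightarrow> (('b \<Rightarrow> complex) \<Rightarrow> 'b \<Rightarrow> complex) set"
  where "End_cspace X =
    {F. Vector_Spaces.linear vscale vscale F \<and> range F \<subseteq> cspace X \<and>
        (\<forall>v. (\<forall>x\<in>X. v x = 0) \<longrightarrow> F v = 0)}"

text \<open>The endomorphism of \<open>\<complex>\<^bsup>X\<^esup>\<close> with prescribed values on the basis vectors.\<close>

definition lin_ext :: "'b set \<Rightarrow> ('b \<Rightarrow> 'b \<Rightarrow> complex) \<Rightarrow> ('b \<Rightarrow> complex) \<Rightarrow> 'b \<Rightarrow> complex"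
  where "lin_ext X f = (\<lambda>v. \<Sum>x\<in>X. vscale (v x) (f x))"

definition End_id :: "'b set \<Rightarrow> ('b \<Rightarrow> complex) \<Rightarrow> 'b \<Rightarrow> complex"
  where "End_id X = lin_ext X bvec"

definition is_subalgebra :: "'b set \<Rightarrow> (('b \<Rightarrow> complex) \<Rightarrow> 'b \<Rightarrow> complex) set \<Rightarrow> bool"
  where "is_subalgebra X S \<longleftrightarrow>
    S \<subseteq> End_cspace X \<and> oper.subspace S \<and> End_id X \<in> S \<and> (\<forall>F\<in>S. \<forall>G\<in>S. F \<circ> G \<in> S)"

definition adj_op :: "'a set \<Rightarrow> nat \<Rightarrow> ('a set \<Rightarrow> complex) \<Rightarrow> 'a set \<Rightarrow> complex"
  where "adj_op \<Omega> k =
    lin_ext (nsets \<Omega> k) (\<lambda>x. \<Sum>y | y \<in> nsets \<Omega> k \<and> card (x \<inter> y) = k - 1. bvec y)"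

definition dual_adj_op ::
    "'a set \<Rightarrow> nat \<Rightarrow> 'a set \<Rightarrow> ('a set \<Rightarrow> complex) \<Rightarrow> 'a set \<Rightarrow> complex"
  where "dual_adj_op \<Omega> k x0 =
    lin_ext (nsets \<Omega> k)
      (\<lambda>x. vscale
        ((of_nat (card \<Omega>) - 1) *
          (1 - of_nat (card \<Omega>) * of_nat (card (x0 - x) + card (x - x0)) /
               (2 * of_nat k * (of_nat (card \<Omega>) - of_nat k))))
        (bvec x))"

definition terwilliger_algebra ::
    "'a set \<Rightarrow> nat \<Rightarrow> 'a set \<Rightarrow> (('a set \<Rightarrow> complex) \<Rightarrow> 'a set \<Rightarrow> complex) set"
  where "terwilliger_algebra \<Omega> k x0 =
    is_subalgebra (nsets \<Omega> k) hull {adj_op \<Omega> k, dual_adj_op \<Omega> k x0}"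

definition Q :: "nat \<Rightarrow> int"
  where "Q n =
    \<lfloor>1/2 * real (n choose 4) + 1/4 * real (n choose 3)
      - 1/8 * real (n choose 2) + 1/16 * real (n choose 1)\<rfloor>"

text \<open>
  The hull above is a subalgebra of \<open>End(\<complex>\<^bsup>X\<^esup>)\<close>: the generators lie in \<open>End(\<complex>\<^bsup>X\<^esup>)\<close>, so the
  intersection is not over the empty family.
\<close>

lemma cspace_sum: "(\<And>x. x \<in> A \<Longrightarrow> f x \<in> cspace X) \<Longrightarrow> sum f A \<in> cspace X"
  by (induction A rule: infinite_finite_induct) (auto simp: cspace_def)

lemma lin_ext_in_End:
  assumes "\<And>x. x \<in> X \<Longrightarrow> f x \<in> cspace X"
  shows "lin_ext X f \<in> End_cspace X"
proof -
  have "lin_ext X f (u + v) = lin_ext X f u + lin_ext X f v" for u v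
    by (simp add: lin_ext_def fvec.scale_left_distrib sum.distrib)
  moreover have "lin_ext X f (vscale c v) = vscale c (lin_ext X f v)" for c v
  proof -
    have "vscale (vscale c v x) (f x) = vscale c (vscale (v x) (f x))" for x
      by (simp add: vscale_def mult.assoc)
    then show ?thesis
      by (simp only: lin_ext_def fvec.scale_sum_right)
  qed
  ultimately have "Vector_Spaces.linear vscale vscale (lin_ext X f)"
    by (simp add: Vector_Spaces.linear_iff fvec.vector_space_axioms)
  moreover have "lin_ext X f v \<in> cspace X" for v
    unfolding lin_ext_def using assms
    by (intro cspace_sum) (auto simp: cspace_def vscale_def)
  moreover have "lin_ext X f v = 0" if "\<forall>x\<in>X. v x = 0" for v
    using that by (simp add: lin_ext_def)
  ultimately show ?thesis
    by (auto simp: End_cspace_def)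
qed

lemma lin_ext_bvec: "finite X \<Longrightarrow> x \<in> X \<Longrightarrow> lin_ext X f (bvec x) = f x"
  by (simp add: lin_ext_def bvec_def if_distrib[of "\<lambda>c. vscale c _"] sum.delta cong: if_cong)

lemma End_id_apply:
  assumes "finite X" "v \<in> cspace X"
  shows "End_id X v = v"
proof -
  have "(\<Sum>x\<in>A. vscale (v x) (bvec x)) y = (if y \<in> A then v y else 0)" if "finite A" for A y
    using that by (induction A) (auto simp: vscale_def bvec_def)
  then show ?thesis
    using assms by (auto simp: End_id_def lin_ext_def cspace_def fun_eq_iff)
qed

lemma bvec_in_cspace: "x \<in> X \<Longrightarrow> bvec x \<in> cspace X"
  by (auto simp: bvec_def cspace_def)

lemma vscale_in_cspace: "v \<in> cspace X \<Longrightarrow> vscale c v \<in> cspace X"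
  by (auto simp: vscale_def cspace_def)

lemma End_id_in_End: "End_id X \<in> End_cspace X"
  unfolding End_id_def by (intro lin_ext_in_End bvec_in_cspace)

lemma adj_op_in_End: "adj_op \<Omega> k \<in> End_cspace (nsets \<Omega> k)"
  unfolding adj_op_def by (intro lin_ext_in_End cspace_sum bvec_in_cspace) auto

lemma dual_adj_op_in_End: "dual_adj_op \<Omega> k x0 \<in> End_cspace (nsets \<Omega> k)"
  unfolding dual_adj_op_def by (intro lin_ext_in_End vscale_in_cspace bvec_in_cspace)

lemma is_subalgebra_End: "is_subalgebra X (End_cspace X)"
proof -
  have comp: "F \<circ> G \<in> End_cspace X" if "F \<in> End_cspace X" "G \<in> End_cspace X" for F G
  proof -
    have "F 0 = 0"
      using that by (simp add: End_cspace_def)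
    then show ?thesis
      using that by (auto simp: End_cspace_def intro: Vector_Spaces.linear_compose)
  qed
  have "oper.subspace (End_cspace X)"
  proof (rule oper.subspaceI)
    show "0 \<in> End_cspace X"
      by (auto simp: End_cspace_def cspace_def Vector_Spaces.linear_iff vscale_def
        fvec.vector_space_axioms fun_eq_iff)
    show "F + G \<in> End_cspace X" if "F \<in> End_cspace X" "G \<in> End_cspace X" for F G
      using that
      by (auto simp: End_cspace_def cspace_def Vector_Spaces.linear_iff image_subset_iff
        fvec.scale_right_distrib)
    show "opscale c F \<in> End_cspace X" if "F \<in> End_cspace X" for c F
      using that
      by (auto simp: End_cspace_def cspace_def Vector_Spaces.linear_iff image_subset_iff
        opscale_def fvec.scale_right_distrib mult.commute) (simp add: vscale_def)
  qed
  then show ?thesis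
    using comp by (auto simp: is_subalgebra_def End_id_in_End)
qed

lemma is_subalgebra_terwilliger_algebra:
  "is_subalgebra (nsets \<Omega> k) (terwilliger_algebra \<Omega> k x0)"
proof -
  have "terwilliger_algebra \<Omega> k x0 \<subseteq> End_cspace (nsets \<Omega> k)"
    unfolding terwilliger_algebra_def
    by (intro hull_minimal is_subalgebra_End) (auto simp: adj_op_in_End dual_adj_op_in_End)
  then show ?thesis
    unfolding is_subalgebra_def terwilliger_algebra_def hull_def oper.subspace_def by blast
qed

end

theory Submission
  imports Defs
begin

text \<open>
  Write \<open>D\<close> for the size of \<open>\<Omega>\<close>. A pair \<open>(y, x)\<close> of \<open>k\<close>-sets is determined, up to permutations of \<open>\<Omega>\<close>
  that fix \<open>x0\<close>, by the sizes \<open>p\<close>, \<open>q\<close> of \<open>x - x0\<close>, \<open>y - x0\<close> and by the numbers \<open>i\<close>, \<open>j\<close> of elements that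
  must be exchanged inside and outside \<open>x0\<close>. Every operator of the Terwilliger algebra is
  constant on these classes. If \<open>D = 2 k\<close>, it is moreover invariant under complementation composed
  with a permutation exchanging \<open>x0\<close> and its complement, which swaps \<open>i\<close> and \<open>j\<close>.

  Conversely, all class indicators lie in the algebra. The dual adjacency operator separates the
  levels \<open>p\<close>, so the parts of the adjacency operator that raise, lower and preserve the level are
  available; the raising and lowering parts give the classes with \<open>i = j = 0\<close>. Comparing up-down with
  down-up walks isolates the single exchange inside \<open>x0\<close> (if \<open>D = 2 k\<close>, only its symmetrization with
  the exchange outside \<open>x0\<close>, together with the simultaneous exchange), and multiplying by these
  exchanges is triangular with respect to \<open>i + j\<close>. The dimension is therefore the number of classes
  that occur, a lattice point count with a quasi-polynomial value.
\<close>

section \<open>Counting classes\<close>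

text \<open>For \<open>p, q <= n\<close> this is the largest value of \<open>sdist\<close> on
  subsets of sizes \<open>p\<close> and \<open>q\<close> of a set of size \<open>n\<close>; see
  \<open>sdist_le_depth\<close> and \<open>exists_pair_sdist\<close>.\<close>

definition depth :: "nat \<Rightarrow> nat \<Rightarrow> nat \<Rightarrow> nat"
  where "depth n p q = min (min p q) (min (n - p) (n - q))"

text \<open>Cut the square along its diagonal. The half \<open>p <= q\<close> corresponds via
  \<open>(p, n - q)\<close> to the triangle \<open>a + b <= n\<close>, the open half
  \<open>q < p\<close> via \<open>(q, n - p)\<close> to \<open>a + b < n\<close>. Each triangle is
  then summed along its antidiagonals \<open>a + b = s\<close>.\<close>

lemma sum_atMost_square_min_max:
  fixes f :: "nat \<Rightarrow> nat \<Rightarrow> 'b::comm_monoid_add"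
  shows "(\<Sum>p\<le>n. \<Sum>q\<le>n. f (min p q) (n - max p q)) =
    (\<Sum>s\<le>n. \<Sum>a\<le>s. f a (s - a)) + (\<Sum>s<n. \<Sum>a\<le>s. f a (s - a))"
proof -
  have "(\<Sum>p\<le>n. \<Sum>q\<le>n. f (min p q) (n - max p q)) =
      (\<Sum>(p, q)\<in>{..n} \<times> {..n}. f (min p q) (n - max p q))"
    by (simp add: sum.cartesian_product)
  also have "{..n} \<times> {..n} = {(p, q). p \<le> q \<and> q \<le> n} \<union> {(p, q). q < p \<and> p \<le> n}"
    by auto
  also have "(\<Sum>(p, q)\<in>\<dots>. f (min p q) (n - max p q)) =
      (\<Sum>(p, q)\<in>{(p, q). p \<le> q \<and> q \<le> n}. f (min p q) (n - max p q)) +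
      (\<Sum>(p, q)\<in>{(p, q). q < p \<and> p \<le> n}. f (min p q) (n - max p q))"
  proof (rule sum.union_disjoint)
    show "finite {(p, q). p \<le> q \<and> q \<le> n}" "finite {(p, q). q < p \<and> p \<le> n}"
      by (rule finite_subset[of _ "{..n} \<times> {..n}"]; auto)+
  qed auto
  also have "(\<Sum>(p, q)\<in>{(p, q). p \<le> q \<and> q \<le> n}. f (min p q) (n - max p q)) =
      (\<Sum>(a, b)\<in>{(a, b). a + b < Suc n}. f a b)"
    by (rule sum.reindex_bij_witness[of _ "\<lambda>(a, b). (a, n - b)" "\<lambda>(p, q). (p, n - q)"]) auto
  also have "(\<Sum>(p, q)\<in>{(p, q). q < p \<and> p \<le> n}. f (min p q) (n - max p q)) =
      (\<Sum>(a, b)\<in>{(a, b). a + b < n}. f a b)"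
    by (rule sum.reindex_bij_witness[of _ "\<lambda>(a, b). (n - b, a)" "\<lambda>(p, q). (q, n - p)"]) auto
  finally show ?thesis
    by (simp add: sum.triangle_reindex lessThan_Suc_atMost)
qed

lemma depth_eq: "depth n p q = min (min p q) (n - max p q)"
  by (auto simp: depth_def min_def max_def)

section \<open>Sums along an antidiagonal\<close>

definition diag_sum :: "nat \<Rightarrow> nat"
  where "diag_sum s = (\<Sum>a\<le>s. Suc (min a (s - a)))"

definition diag_sum_tri :: "nat \<Rightarrow> nat"
  where "diag_sum_tri s = (\<Sum>a\<le>s. \<Sum>i\<le>min a (s - a). Suc i)"

definition diag_sum_wt :: "nat \<Rightarrow> nat"
  where "diag_sum_wt s = (\<Sum>a\<le>s. Suc (min a (s - a)) * Suc a)"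

text \<open>At the two endpoints the minimum is 0; shifting the inner points by one lowers their
  minimum by one. This recursion in steps of two is the source of the parity terms below.\<close>

lemma sum_diag_Suc_Suc:
  fixes f :: "nat \<Rightarrow> nat"
  shows "(\<Sum>a\<le>Suc (Suc s). f (min a (Suc (Suc s) - a))) =
    2 * f 0 + (\<Sum>a\<le>s. f (Suc (min a (s - a))))"
proof -
  have "(\<Sum>a\<le>Suc (Suc s). f (min a (Suc (Suc s) - a))) =
      f 0 + (\<Sum>a\<le>Suc s. f (min (Suc a) (Suc s - a)))"
    by (subst sum.atMost_Suc_shift) simp
  also have "(\<Sum>a\<le>Suc s. f (min (Suc a) (Suc s - a))) =
      (\<Sum>a\<le>s. f (min (Suc a) (Suc s - a))) + f 0"
    by simp
  also have "(\<Sum>a\<le>s. f (min (Suc a) (Suc s - a))) = (\<Sum>a\<le>s. f (Suc (min a (s - a))))"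
    by (intro sum.cong refl) (auto simp: Suc_diff_le)
  finally show ?thesis by simp
qed

lemma diag_sum_Suc_Suc: "diag_sum (Suc (Suc s)) = s + 3 + diag_sum s"
  unfolding diag_sum_def sum_diag_Suc_Suc[where f = Suc]
  by (simp add: sum.distrib flip: add_Suc_right)
     (simp add: sum_Suc)

lemma diag_sum_tri_Suc_Suc:
  "diag_sum_tri (Suc (Suc s)) = diag_sum_tri s + diag_sum (Suc (Suc s))"
  unfolding diag_sum_tri_def diag_sum_def
    sum_diag_Suc_Suc[where f = "\<lambda>m. \<Sum>i\<le>m. Suc i"] sum_diag_Suc_Suc[where f = Suc]
  by (simp flip: sum.distrib)

lemma four_diag_sum: "4 * int (diag_sum s) = (int s + 2)\<^sup>2 - of_bool (odd s)"
proof (induction s rule: nat_induct2)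
  case (step s)
  have "4 * int (diag_sum (s + 2)) = 4 * (int s + 3) + 4 * int (diag_sum s)"
    using diag_sum_Suc_Suc[of s] by simp
  then show ?case
    unfolding step by (simp add: power2_eq_square algebra_simps)
qed (auto simp: diag_sum_def)

text \<open>The reflection \<open>a -> s - a\<close> fixes the minimum, so the weight
  \<open>Suc a\<close> may be replaced by its average \<open>(s + 2) / 2\<close>, which reduces the
  claim to \<open>four_diag_sum\<close>.\<close>

lemma eight_diag_sum_wt:
  "8 * int (diag_sum_wt s) = (int s + 2) * ((int s + 2)\<^sup>2 - of_bool (odd s))"
proof -
  have "diag_sum_wt s = (\<Sum>a\<le>s. Suc (min a (s - a)) * Suc (s - a))"
    unfolding diag_sum_wt_def
    by (rule sum.reindex_bij_witness[of _ "\<lambda>a. s - a" "\<lambda>a. s - a"]) (auto simp: min.commute)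
  then have "2 * diag_sum_wt s =
      (\<Sum>a\<le>s. Suc (min a (s - a)) * Suc a + Suc (min a (s - a)) * Suc (s - a))"
    unfolding mult_2 by (subst sum.distrib) (simp only: diag_sum_wt_def)
  also have "\<dots> = (\<Sum>a\<le>s. Suc (min a (s - a)) * (s + 2))"
    by (intro sum.cong refl) (simp only: distrib_left[symmetric], simp)
  also have "\<dots> = (s + 2) * diag_sum s"
    by (simp add: diag_sum_def sum_distrib_left mult.commute)
  finally have "2 * int (diag_sum_wt s) = (int s + 2) * int (diag_sum s)"
    by (metis of_nat_add of_nat_mult of_nat_numeral)
  then show ?thesis
    unfolding four_diag_sum[symmetric] by simp
qed

lemma twentyfour_diag_sum_tri:
  "24 * int (diag_sum_tri s) = (int s + 3) * ((int s + 2) * (int s + 4) - 3 * of_bool (odd s))"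
proof (induction s rule: nat_induct2)
  case (step s)
  have "24 * int (diag_sum_tri (s + 2)) =
      24 * int (diag_sum_tri s) + 6 * (4 * int (diag_sum (s + 2)))"
    using diag_sum_tri_Suc_Suc[of s] by simp
  then show ?case
    unfolding step four_diag_sum by (simp add: power2_eq_square algebra_simps)
qed (auto simp: diag_sum_tri_def)

text \<open>By \<open>diag_sum_tri_Suc_Suc\<close> each \<open>diag_sum\<close> is a difference of
  \<open>diag_sum_tri\<close> at distance two, so the sum telescopes separately over even and odd
  indices.\<close>

lemma sum_diag_sum:
  "(\<Sum>s\<le>Suc m. diag_sum s) = diag_sum_tri (Suc m) + diag_sum_tri m"
proof (induction m)
  case (Suc m)
  then show ?case
    using diag_sum_tri_Suc_Suc[of m] by simp
qed (simp add: diag_sum_def diag_sum_tri_def)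

section \<open>Class counts and their quasi-polynomial values\<close>

text \<open>The inner sum is the number of pairs \<open>i <= j <= depth n p q\<close>, that is, of
  unordered exchange numbers. This is the count for \<open>D = 2 k\<close>, with
  \<open>n = k\<close>.\<close>

definition sym_class_count :: "nat \<Rightarrow> nat"
  where "sym_class_count n = (\<Sum>p\<le>n. \<Sum>q\<le>n. \<Sum>i\<le>depth n p q. Suc i)"

text \<open>Counts the tuples \<open>(p, q, i, j)\<close> when \<open>i\<close> and \<open>j\<close>
  range independently. It is used with \<open>n\<close> the smaller and \<open>m\<close> the larger
  of \<open>k\<close> and \<open>D - k\<close>; the levels are bounded by the smaller one.\<close>

definition class_count :: "nat \<Rightarrow> nat \<Rightarrow> nat"
  where "class_count n m = (\<Sum>p\<le>n. \<Sum>q\<le>n. Suc (depth n p q) * Suc (depth m p q))"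

lemma sym_class_count_eq:
  "sym_class_count n = (\<Sum>s\<le>n. diag_sum_tri s) + (\<Sum>s<n. diag_sum_tri s)"
  unfolding sym_class_count_def depth_eq diag_sum_tri_def
  by (rule sum_atMost_square_min_max[where f = "\<lambda>a b. \<Sum>i\<le>min a b. Suc i"])

lemma sym_class_count_Suc:
  "sym_class_count (Suc n) = sym_class_count n + (\<Sum>s\<le>Suc n. diag_sum s)"
  unfolding sum_diag_sum sym_class_count_eq by (simp flip: lessThan_Suc_atMost)

lemma sym_class_count_formula:
  "48 * int (sym_class_count n) =
    (int n + 4) * (int n + 2) * ((int n + 4) * (int n + 2) - 2) - 3 * of_bool (odd n)"
proof (induction n)
  case (Suc n)
  have "48 * int (sym_class_count (Suc n)) = 48 * int (sym_class_count n) +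
      2 * (24 * int (diag_sum_tri (Suc n))) + 2 * (24 * int (diag_sum_tri n))"
    by (simp add: sym_class_count_Suc sum_diag_sum del: sum.atMost_Suc)
  then show ?case
    unfolding Suc twentyfour_diag_sum_tri by (cases "even n") (simp_all add: algebra_simps)
qed (simp add: sym_class_count_eq diag_sum_tri_def)

text \<open>The expression under the floor equals the count for even \<open>n\<close> and exceeds it
  by 1/16 for odd \<open>n\<close>.\<close>

lemma Q_eq_sym_class_count: "Q (n + 4) = int (sym_class_count n)"
proof -
  define x where "x = real n"
  have c4: "real (n + 4 choose 4) = (x + 4) * (x + 3) * (x + 2) * (x + 1) / 24"
    and c3: "real (n + 4 choose 3) = (x + 4) * (x + 3) * (x + 2) / 6"
    and c2: "real (n + 4 choose 2) = (x + 4) * (x + 3) / 2"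
    by (simp_all add: x_def binomial_gbinomial gbinomial_prod_rev numeral_eq_Suc field_simps)
  have "real_of_int (48 * int (sym_class_count n)) =
     (x + 4) * (x + 2) * ((x + 4) * (x + 2) - 2) - 3 * of_bool (odd n)"
    unfolding sym_class_count_formula by (simp add: x_def)
  then have "real (sym_class_count n) =
     ((x + 4) * (x + 2) * ((x + 4) * (x + 2) - 2) - 3 * of_bool (odd n)) / 48"
    by simp
  then have "1/2 * real (n + 4 choose 4) + 1/4 * real (n + 4 choose 3)
      - 1/8 * real (n + 4 choose 2) + 1/16 * real (n + 4 choose 1) =
      real (sym_class_count n) + of_bool (odd n) / 16"
    unfolding c4 c3 c2 by (simp add: x_def field_simps)
  then show ?thesis
    unfolding Q_def by (cases "odd n") (simp_all add: floor_eq_iff)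
qed

text \<open>For \<open>p, q <= n\<close> and \<open>2 * n <= m\<close> the bound
  \<open>m - max p q\<close> is at least \<open>n\<close>, so the second depth is just
  \<open>min p q\<close>. The count then no longer depends on \<open>m\<close> and is a sum over the
  square as above.\<close>

lemma class_count_double:
  assumes "2 * n \<le> m"
  shows "class_count n m = (n + 3 choose 4) + sym_class_count n"
proof -
  have "class_count n m = (\<Sum>p\<le>n. \<Sum>q\<le>n. Suc (min (min p q) (n - max p q)) * Suc (min p q))"
    unfolding class_count_def depth_eq using assms
    by (intro sum.cong refl) (auto simp: min_def max_def)
  also have "\<dots> = (\<Sum>s\<le>n. diag_sum_wt s) + (\<Sum>s<n. diag_sum_wt s)"
    unfolding diag_sum_wt_def
    by (rule sum_atMost_square_min_max[where f = "\<lambda>a b. Suc (min a b) * Suc a"])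
  also have "\<dots> = (n + 3 choose 4) + sym_class_count n"
  proof (induction n)
    case (Suc n)
    define x where "x = int n"
    have "6 * real (n + 3 choose 3) = (real n + 3) * (real n + 2) * (real n + 1)"
      by (simp add: binomial_gbinomial gbinomial_prod_rev numeral_eq_Suc field_simps)
    then have "real_of_int (6 * int (n + 3 choose 3)) = real_of_int ((x + 3) * (x + 2) * (x + 1))"
      by (simp add: x_def)
    then have c3: "6 * int (n + 3 choose 3) = (x + 3) * (x + 2) * (x + 1)"
      by (simp only: of_int_eq_iff)
    \<comment> \<open>The increments of both sides agree: 24 is a common denominator of the three
      closed forms involved, and the parity terms of \<open>n\<close> and \<open>Suc n\<close>
      cancel.\<close>
    have "24 * (int (diag_sum_wt (Suc n)) + int (diag_sum_wt n)) =
        24 * (int (n + 3 choose 3) + int (diag_sum_tri (Suc n)) + int (diag_sum_tri n))"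
      using eight_diag_sum_wt[of "Suc n"] eight_diag_sum_wt[of n] c3
        twentyfour_diag_sum_tri[of "Suc n"] twentyfour_diag_sum_tri[of n]
      by (cases "even n") (simp_all add: x_def power2_eq_square algebra_simps)
    then have "int (diag_sum_wt (Suc n) + diag_sum_wt n) =
        int ((n + 3 choose 3) + diag_sum_tri (Suc n) + diag_sum_tri n)"
      by (simp only: of_nat_add mult_cancel_left) simp
    then have "diag_sum_wt (Suc n) + diag_sum_wt n =
        (n + 3 choose 3) + diag_sum_tri (Suc n) + diag_sum_tri n"
      by (simp only: of_nat_eq_iff)
    moreover have "(Suc n + 3 choose 4) = (n + 3 choose 3) + (n + 3 choose 4)"
      by (simp add: numeral_eq_Suc)
    moreover have "(\<Sum>s\<le>Suc n. diag_sum_wt s) + (\<Sum>s<Suc n. diag_sum_wt s) =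
        (\<Sum>s\<le>n. diag_sum_wt s) + (\<Sum>s<n. diag_sum_wt s) + (diag_sum_wt (Suc n) + diag_sum_wt n)"
      by simp
    ultimately show ?case
      using Suc sym_class_count_Suc[of n] sum_diag_sum[of n] by simp
  qed (simp add: sym_class_count_eq diag_sum_wt_def diag_sum_tri_def)
  finally show ?thesis .
qed

text \<open>Raising \<open>m\<close> by one raises \<open>depth m p q\<close> by one exactly in the
  corner \<open>p + q > m\<close>. The reflection \<open>(p, q) -> (n - p, n - q)\<close> turns this
  corner into the triangle \<open>a + b < 2 * n - m\<close>, on which \<open>depth n\<close> becomes
  \<open>min a b\<close>.\<close>

lemma class_count_Suc:
  assumes "n \<le> m" "m < 2 * n"
  shows "class_count n (Suc m) = class_count n m + (\<Sum>s<2 * n - m. diag_sum s)"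
proof -
  have d: "depth (Suc m) p q = depth m p q + of_bool (p + q > m)" if "p \<le> n" "q \<le> n" for p q
    using that assms by (auto simp: depth_eq min_def max_def)
  have "class_count n (Suc m) =
      (\<Sum>p\<le>n. \<Sum>q\<le>n. Suc (depth n p q) * Suc (depth m p q) + Suc (depth n p q) * of_bool (p + q > m))"
    unfolding class_count_def by (intro sum.cong refl) (simp add: d)
  also have "\<dots> = class_count n m + (\<Sum>p\<le>n. \<Sum>q\<le>n. Suc (depth n p q) * of_bool (p + q > m))"
    by (simp add: class_count_def sum.distrib del: mult_Suc mult_Suc_right)
  also have "(\<Sum>p\<le>n. \<Sum>q\<le>n. Suc (depth n p q) * of_bool (p + q > m)) =
      (\<Sum>(p, q)\<in>{..n} \<times> {..n}. Suc (depth n p q) * of_bool (p + q > m))"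
    by (simp add: sum.cartesian_product)
  also have "\<dots> = (\<Sum>(p, q)\<in>{(p, q). p \<le> n \<and> q \<le> n \<and> p + q > m}. Suc (depth n p q))"
    by (rule sum.mono_neutral_cong_right) auto
  also have "\<dots> = (\<Sum>(a, b)\<in>{(a, b). a + b < 2 * n - m}. Suc (min a b))"
    by (rule sum.reindex_bij_witness[of _ "\<lambda>(a, b). (n - a, n - b)" "\<lambda>(a, b). (n - a, n - b)"])
      (use assms in \<open>auto simp: depth_eq min_def max_def\<close>)
  also have "\<dots> = (\<Sum>s<2 * n - m. diag_sum s)"
    by (simp add: sum.triangle_reindex diag_sum_def)
  finally show ?thesis .
qed

text \<open>Descending from \<open>m = 2 * n\<close>, each step loses one triangle of
  \<open>class_count_Suc\<close>. By \<open>sym_class_count_Suc\<close> these losses are exactly the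
  increments of \<open>sym_class_count\<close>.\<close>

lemma class_count_add:
  assumes "e < n"
  shows "class_count n (2 * n - Suc e) + sym_class_count e = class_count n (2 * n)"
  using assms
proof (induction e)
  case 0
  then have "Suc (2 * n - 1) = 2 * n" "2 * n - (2 * n - 1) = 1"
    by auto
  then show ?case
    using class_count_Suc[of n "2 * n - 1"] 0
    by (simp add: sym_class_count_eq diag_sum_def diag_sum_tri_def)
next
  case (Suc e)
  then have *: "Suc (2 * n - Suc (Suc e)) = 2 * n - Suc e"
    "2 * n - (2 * n - Suc (Suc e)) = Suc (Suc e)" "n \<le> 2 * n - Suc (Suc e)"
    by auto
  have "class_count n (2 * n - Suc e) =
      class_count n (2 * n - Suc (Suc e)) + (\<Sum>s\<le>Suc e. diag_sum s)"
    using class_count_Suc[of n "2 * n - Suc (Suc e)"] Suc.prems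
    unfolding * by (simp del: sum.atMost_Suc add: lessThan_Suc_atMost *)
  then show ?case
    using Suc by (simp add: sym_class_count_Suc)
qed

lemma class_count_formula:
  assumes "n < m"
  shows "int (class_count n m) =
    int (n + 3 choose 4) + Q (n + 4) - (if m \<le> 2 * n then Q (2 * n - m + 3) else 0)"
proof (cases "m < 2 * n")
  case True
  define e where "e = 2 * n - m - 1"
  have e: "m = 2 * n - Suc e" "2 * n - m + 3 = e + 4" "e < n"
    using True assms by (auto simp: e_def)
  show ?thesis
    using class_count_add[OF e(3)] class_count_double[of n "2 * n"] True
    unfolding e(1)[symmetric] by (simp add: e(2) Q_eq_sym_class_count)
next
  case False
  \<comment> \<open>The correction term is also written at the boundary \<open>m = 2 * n\<close>,
    where it must vanish.\<close>
  have "Q 3 = 0"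
    by (simp add: Q_def numeral_eq_Suc)
  then show ?thesis
    using False class_count_double[of n m] by (auto simp: Q_eq_sym_class_count not_less)
qed

section \<open>Operators given by kernels\<close>

text \<open>The operator with matrix \<open>K\<close>, rows indexed by \<open>y\<close> and columns
  by \<open>x\<close>. Coordinates outside \<open>X\<close> are neither read nor produced, as
  \<open>End_cspace\<close> demands, so only the values of \<open>K\<close> on pairs from
  \<open>X\<close> matter.\<close>

definition kop :: "'b set \<Rightarrow> ('b \<Rightarrow> 'b \<Rightarrow> complex) \<Rightarrow> ('b \<Rightarrow> complex) \<Rightarrow> 'b \<Rightarrow> complex"
  where "kop X K = (\<lambda>v y. if y \<in> X then \<Sum>x\<in>X. K y x * v x else 0)"

lemma sum_fun_apply: "(\<Sum>i\<in>A. f i) x = (\<Sum>i\<in>A. f i x)"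
  by (induction A rule: infinite_finite_induct) auto

lemma lin_ext_eq_kop:
  assumes "\<And>x. x \<in> X \<Longrightarrow> f x \<in> cspace X"
  shows "lin_ext X f = kop X (\<lambda>y x. f x y)"
proof -
  have "(\<Sum>x\<in>X. v x * f x y) = 0" if "y \<notin> X" for v y
    using assms that by (intro sum.neutral) (auto simp: cspace_def)
  then show ?thesis
    by (auto simp: lin_ext_def kop_def fun_eq_iff sum_fun_apply vscale_def mult.commute)
qed

lemma kop_cong: "(\<And>y x. y \<in> X \<Longrightarrow> x \<in> X \<Longrightarrow> K y x = L y x) \<Longrightarrow> kop X K = kop X L"
  by (auto simp: kop_def fun_eq_iff intro!: sum.cong)

lemma kop_bvec: "finite X \<Longrightarrow> x \<in> X \<Longrightarrow> y \<in> X \<Longrightarrow> kop X K (bvec x) y = K y x"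
  by (simp add: kop_def bvec_def if_distrib[of "\<lambda>c. _ * c"] sum.delta cong: if_cong)

lemma kop_eq_iff:
  assumes "finite X"
  shows "kop X K = kop X L \<longleftrightarrow> (\<forall>y\<in>X. \<forall>x\<in>X. K y x = L y x)"
  using kop_bvec[OF assms] kop_cong[of X K L] by metis

lemma kop_add: "kop X K + kop X L = kop X (\<lambda>y x. K y x + L y x)"
  by (auto simp: kop_def fun_eq_iff sum.distrib algebra_simps)

lemma opscale_kop: "opscale c (kop X K) = kop X (\<lambda>y x. c * K y x)"
  by (auto simp: kop_def opscale_def vscale_def fun_eq_iff sum_distrib_left mult.assoc)

lemma kop_zero: "kop X (\<lambda>y x. 0) = 0"
  by (auto simp: kop_def fun_eq_iff)

lemma kop_sum: "(\<Sum>i\<in>A. kop X (K i)) = kop X (\<lambda>y x. \<Sum>i\<in>A. K i y x)"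
  by (induction A rule: infinite_finite_induct) (auto simp: kop_zero kop_add)

lemma kop_comp: "kop X K \<circ> kop X L = kop X (\<lambda>y x. \<Sum>z\<in>X. K y z * L z x)"
proof -
  have "(\<Sum>z\<in>X. K y z * (if z \<in> X then \<Sum>x\<in>X. L z x * v x else 0)) =
      (\<Sum>x\<in>X. (\<Sum>z\<in>X. K y z * L z x) * v x)" for v y
  proof -
    have "(\<Sum>z\<in>X. K y z * (if z \<in> X then \<Sum>x\<in>X. L z x * v x else 0)) =
        (\<Sum>z\<in>X. \<Sum>x\<in>X. K y z * L z x * v x)"
      by (intro sum.cong refl) (simp add: sum_distrib_left mult.assoc)
    then show ?thesis
      by (subst (asm) sum.swap) (simp add: sum_distrib_right)
  qed
  then show ?thesis
    by (auto simp: kop_def fun_eq_iff)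
qed

lemma kop_in_End: "kop X K \<in> End_cspace X"
proof -
  have "kop X K = lin_ext X (\<lambda>x y. if y \<in> X then K y x else 0)"
    by (subst lin_ext_eq_kop) (auto simp: cspace_def intro!: kop_cong)
  then show ?thesis
    by (auto simp: cspace_def intro!: lin_ext_in_End)
qed

lemma End_id_eq_kop: "End_id X = kop X (\<lambda>y x. of_bool (y = x))"
  unfolding End_id_def
  by (subst lin_ext_eq_kop) (rule bvec_in_cspace, simp, intro kop_cong, simp add: bvec_def)

text \<open>If the maps in \<open>G\<close> permute \<open>X\<close>, this is the commutant of their
  permutation matrices.\<close>

definition invariant_ops :: "'b set \<Rightarrow> ('b \<Rightarrow> 'b) set \<Rightarrow> (('b \<Rightarrow> complex) \<Rightarrow> 'b \<Rightarrow> complex) set"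
  where "invariant_ops X G =
    {kop X K | K. \<forall>g\<in>G. \<forall>y\<in>X. \<forall>x\<in>X. K (g y) (g x) = K y x}"

lemma kop_invariantI:
  "(\<And>g y x. g \<in> G \<Longrightarrow> y \<in> X \<Longrightarrow> x \<in> X \<Longrightarrow> K (g y) (g x) = K y x) \<Longrightarrow> kop X K \<in> invariant_ops X G"
  unfolding invariant_ops_def by (intro CollectI exI[of _ K]) simp

lemma is_subalgebra_invariant_ops:
  assumes G: "\<And>g. g \<in> G \<Longrightarrow> bij_betw g X X"
  shows "is_subalgebra X (invariant_ops X G)"
proof -
  have inj: "g y = g x \<longleftrightarrow> y = x" if "g \<in> G" "y \<in> X" "x \<in> X" for g x y
    using G[OF that(1)] that by (auto simp: bij_betw_def inj_on_def)
  have "oper.subspace (invariant_ops X G)"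
  proof (rule oper.subspaceI)
    show "0 \<in> invariant_ops X G"
      unfolding kop_zero[of X, symmetric] by (rule kop_invariantI) simp
    fix F H assume "F \<in> invariant_ops X G" "H \<in> invariant_ops X G"
    then obtain K L where K: "F = kop X K" "H = kop X L"
      "\<And>g y x. g \<in> G \<Longrightarrow> y \<in> X \<Longrightarrow> x \<in> X \<Longrightarrow> K (g y) (g x) = K y x"
      "\<And>g y x. g \<in> G \<Longrightarrow> y \<in> X \<Longrightarrow> x \<in> X \<Longrightarrow> L (g y) (g x) = L y x"
      unfolding invariant_ops_def by blast
    show "F + H \<in> invariant_ops X G"
      unfolding K(1,2) kop_add by (rule kop_invariantI) (simp add: K)
    show "opscale c F \<in> invariant_ops X G" for c
      unfolding K(1) opscale_kop by (rule kop_invariantI) (simp add: K)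
  qed
  moreover have "F \<circ> H \<in> invariant_ops X G"
    if "F \<in> invariant_ops X G" "H \<in> invariant_ops X G" for F H
  proof -
    from that obtain K L where K: "F = kop X K" "H = kop X L"
      "\<And>g y x. g \<in> G \<Longrightarrow> y \<in> X \<Longrightarrow> x \<in> X \<Longrightarrow> K (g y) (g x) = K y x"
      "\<And>g y x. g \<in> G \<Longrightarrow> y \<in> X \<Longrightarrow> x \<in> X \<Longrightarrow> L (g y) (g x) = L y x"
      unfolding invariant_ops_def by blast
    \<comment> \<open>Matrix products stay invariant: substitute \<open>g z\<close> for the
      summation index.\<close>
    have "(\<Sum>z\<in>X. K (g y) z * L z (g x)) = (\<Sum>z\<in>X. K y z * L z x)"
      if "g \<in> G" "y \<in> X" "x \<in> X" for g y x
      by (subst sum.reindex_bij_betw[OF G[OF that(1)], symmetric])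
        (intro sum.cong refl, simp add: K that)
    then show ?thesis
      unfolding K(1,2) kop_comp by (intro kop_invariantI)
  qed
  moreover have "End_id X \<in> invariant_ops X G"
    unfolding End_id_eq_kop by (rule kop_invariantI) (simp add: inj)
  moreover have "invariant_ops X G \<subseteq> End_cspace X"
    by (auto simp: invariant_ops_def kop_in_End)
  ultimately show ?thesis
    by (simp add: is_subalgebra_def)
qed

section \<open>Matrices that are constant on classes of pairs\<close>

definition class_ops :: "'b set \<Rightarrow> ('b \<Rightarrow> 'b \<Rightarrow> 'c) \<Rightarrow> (('b \<Rightarrow> complex) \<Rightarrow> 'b \<Rightarrow> complex) set"
  where "class_ops X cls = range (\<lambda>f. kop X (\<lambda>y x. f (cls y x)))"

definition class_op :: "'b set \<Rightarrow> ('b \<Rightarrow> 'b \<Rightarrow> 'c) \<Rightarrow> 'c \<Rightarrow> ('b \<Rightarrow> complex) \<Rightarrow> 'b \<Rightarrow> complex"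
  where "class_op X cls c = kop X (\<lambda>y x. of_bool (cls y x = c))"

lemma class_op_in_class_ops: "class_op X cls c \<in> class_ops X cls"
  unfolding class_op_def class_ops_def
  by (rule range_eqI[where x = "\<lambda>d. of_bool (d = c)"]) (rule refl)

text \<open>The hypothesis speaks of invariant kernels instead of orbits, so that a caller may reach
  the second pair by any chain of maps from \<open>G\<close>.\<close>

lemma invariant_ops_subset_class_ops:
  assumes "\<And>K y x y' x'. (\<And>g y x. g \<in> G \<Longrightarrow> y \<in> X \<Longrightarrow> x \<in> X \<Longrightarrow> K (g y) (g x) = K y x) \<Longrightarrow>
      y \<in> X \<Longrightarrow> x \<in> X \<Longrightarrow> y' \<in> X \<Longrightarrow> x' \<in> X \<Longrightarrow> cls y x = cls y' x' \<Longrightarrow> (K y x :: complex) = K y' x'"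
  shows "invariant_ops X G \<subseteq> class_ops X cls"
proof
  fix F assume "F \<in> invariant_ops X G"
  then obtain K where K: "F = kop X K"
    "\<And>g y x. g \<in> G \<Longrightarrow> y \<in> X \<Longrightarrow> x \<in> X \<Longrightarrow> K (g y) (g x) = K y x"
    unfolding invariant_ops_def by blast
  \<comment> \<open>\<open>f\<close> reads \<open>K\<close> at a chosen representative of each
    class; a label without a representative gets an arbitrary value.\<close>
  define f where "f c = (let (y, x) = SOME (y, x). y \<in> X \<and> x \<in> X \<and> cls y x = c in K y x)" for c
  have "f (cls y x) = K y x" if "y \<in> X" "x \<in> X" for y x
  proof -
    obtain y' x' where s: "(SOME (y', x'). y' \<in> X \<and> x' \<in> X \<and> cls y' x' = cls y x) = (y', x')"
      by fastforce
    have "case (y', x') of (y', x') \<Rightarrow> y' \<in> X \<and> x' \<in> X \<and> cls y' x' = cls y x"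
      unfolding s[symmetric] by (rule someI[of _ "(y, x)"]) (use that in auto)
    then show ?thesis
      using assms[of K y' x' y x] K(2) that by (simp add: f_def s)
  qed
  then have "F = kop X (\<lambda>y x. f (cls y x))"
    unfolding K(1) by (intro kop_cong) simp
  then show "F \<in> class_ops X cls"
    by (auto simp: class_ops_def)
qed

lemma kop_class_eq_sum:
  assumes "finite X"
  shows "kop X (\<lambda>y x. f (cls y x)) =
    (\<Sum>c\<in>(\<lambda>(y, x). cls y x) ` (X \<times> X). opscale (f c) (class_op X cls c))"
proof -
  let ?C = "(\<lambda>(y, x). cls y x) ` (X \<times> X)"
  have fin: "finite ?C"
    using assms by simp
  have "(\<Sum>c\<in>?C. f c * of_bool (cls y x = c)) = f (cls y x)" if "y \<in> X" "x \<in> X" for y x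
  proof -
    have "(\<Sum>c\<in>?C. f c * of_bool (cls y x = c)) = (\<Sum>c\<in>?C. if c = cls y x then f c else 0)"
      by (intro sum.cong) auto
    also have "\<dots> = f (cls y x)"
      using that fin by (subst sum.delta) force+
    finally show ?thesis .
  qed
  then show ?thesis
    unfolding class_op_def opscale_kop kop_sum by (intro kop_cong) simp
qed

lemma class_op_eq_zero:
  "(\<And>y x. y \<in> X \<Longrightarrow> x \<in> X \<Longrightarrow> cls y x \<noteq> c) \<Longrightarrow> class_op X cls c = 0"
  unfolding class_op_def kop_zero[of X, symmetric] by (intro kop_cong) simp

lemma class_ops_subsetI:
  assumes "finite X" "is_subalgebra X S" "\<And>c. class_op X cls c \<in> S"
  shows "class_ops X cls \<subseteq> S"
proof
  have sub: "oper.subspace S"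
    using assms by (simp add: is_subalgebra_def)
  fix F assume "F \<in> class_ops X cls"
  then obtain f where F: "F = kop X (\<lambda>y x. f (cls y x))"
    unfolding class_ops_def by (elim rangeE)
  show "F \<in> S"
    unfolding F kop_class_eq_sum[OF assms(1), of f]
    by (intro oper.subspace_sum[OF sub] oper.subspace_scale[OF sub] assms(3))
qed

text \<open>The indicators of the labels that occur have nonempty, pairwise disjoint supports, hence
  form a basis.\<close>

lemma dim_class_ops:
  assumes "finite X"
  shows "oper.dim (class_ops X cls) = card ((\<lambda>(y, x). cls y x) ` (X \<times> X))"
proof -
  let ?C = "(\<lambda>(y, x). cls y x) ` (X \<times> X)"
  have fin: "finite ?C"
    using assms by simp
  have inj: "inj_on (class_op X cls) ?C"
  proof (rule inj_onI)
    fix c c' assume "c \<in> ?C" and eq: "class_op X cls c = class_op X cls c'"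
    then obtain y x where "y \<in> X" "x \<in> X" "c = cls y x"
      by auto
    then show "c = c'"
      using eq unfolding class_op_def kop_eq_iff[OF assms] by force
  qed
  have scalars_zero: "u F = 0"
    if sum0: "(\<Sum>F\<in>class_op X cls ` ?C. opscale (u F) F) = 0" and "F \<in> class_op X cls ` ?C"
    for u F
  proof -
    from that(2) obtain y x where yx: "y \<in> X" "x \<in> X" "F = class_op X cls (cls y x)"
      by auto
    have "kop X (\<lambda>y x. u (class_op X cls (cls y x))) = kop X (\<lambda>y x. 0)"
      using sum0 unfolding sum.reindex[OF inj] kop_zero comp_def
      by (subst kop_class_eq_sum[OF assms, of "\<lambda>c. u (class_op X cls c)"])
    then show "u F = 0"
      using yx(1,2) unfolding kop_eq_iff[OF assms] yx(3) by blast
  qed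
  have indep: "oper.independent (class_op X cls ` ?C)"
  proof
    assume "oper.dependent (class_op X cls ` ?C)"
    then obtain u where u: "\<exists>F\<in>class_op X cls ` ?C. u F \<noteq> 0"
      "(\<Sum>F\<in>class_op X cls ` ?C. opscale (u F) F) = 0"
      unfolding oper.dependent_finite[OF finite_imageI[OF fin]] by (elim exE conjE)
    from u(1) obtain F where "F \<in> class_op X cls ` ?C" "u F \<noteq> 0"
      by (elim bexE)
    then show False
      using scalars_zero[OF u(2)] by simp
  qed
  have sub: "class_op X cls ` ?C \<subseteq> class_ops X cls"
    by (intro image_subsetI class_op_in_class_ops)
  have span: "class_ops X cls \<subseteq> oper.span (class_op X cls ` ?C)"
  proof
    fix F assume "F \<in> class_ops X cls"
    then obtain f where F: "F = kop X (\<lambda>y x. f (cls y x))"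
      unfolding class_ops_def by (elim rangeE)
    show "F \<in> oper.span (class_op X cls ` ?C)"
      unfolding F kop_class_eq_sum[OF assms, of f]
      by (intro oper.span_sum oper.span_scale oper.span_base imageI)
  qed
  show ?thesis
    by (rule oper.dim_unique[OF sub span indep card_image[OF inj]])
qed

text \<open>Expand \<open>M\<close> in class indicators. All terms other than that of
  \<open>c\<close> lie in \<open>S\<close> already, so subtracting them and dividing by the nonzero
  coefficient of \<open>c\<close> isolates its indicator.\<close>

lemma class_op_mem_triangular:
  assumes "finite X" and S: "is_subalgebra X S" "S \<subseteq> class_ops X cls" and M: "kop X M \<in> S"
    and nz: "\<And>y x. y \<in> X \<Longrightarrow> x \<in> X \<Longrightarrow> cls y x = c \<Longrightarrow> M y x \<noteq> 0"
    and supp: "\<And>y x. y \<in> X \<Longrightarrow> x \<in> X \<Longrightarrow> M y x \<noteq> 0 \<Longrightarrow> cls y x \<noteq> c \<Longrightarrow>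
      class_op X cls (cls y x) \<in> S"
  shows "class_op X cls c \<in> S"
proof -
  let ?C = "(\<lambda>(y, x). cls y x) ` (X \<times> X)"
  have sub: "oper.subspace S"
    using S by (simp add: is_subalgebra_def)
  show ?thesis
  proof (cases "c \<in> ?C")
    case False
    then have "class_op X cls c = 0"
      by (intro class_op_eq_zero) force
    then show ?thesis
      using oper.subspace_0[OF sub] by simp
  next
    case True
    obtain f where f: "kop X M = kop X (\<lambda>y x. f (cls y x))"
      using M S by (auto simp: class_ops_def)
    then have Mf: "M y x = f (cls y x)" if "y \<in> X" "x \<in> X" for y x
      using that unfolding kop_eq_iff[OF assms(1)] by simp
    have "f c \<noteq> 0"
      using True nz Mf by fastforce
    have "opscale (f c') (class_op X cls c') \<in> S" if "c' \<in> ?C - {c}" for c'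
    proof (cases "f c' = 0")
      case True
      then show ?thesis
        using oper.subspace_0[OF sub] by simp
    next
      case False
      then show ?thesis
        using that Mf supp by (intro oper.subspace_scale[OF sub]) auto
    qed
    then have "(\<Sum>c'\<in>?C - {c}. opscale (f c') (class_op X cls c')) \<in> S"
      by (intro oper.subspace_sum[OF sub])
    moreover have "kop X M = opscale (f c) (class_op X cls c) +
        (\<Sum>c'\<in>?C - {c}. opscale (f c') (class_op X cls c'))"
      unfolding f kop_class_eq_sum[OF assms(1), of f] using True assms(1)
      by (intro sum.remove) auto
    ultimately have "opscale (f c) (class_op X cls c) \<in> S"
      using oper.subspace_diff[OF sub M] by fastforce
    then have "opscale (1 / f c) (opscale (f c) (class_op X cls c)) \<in> S"
      by (rule oper.subspace_scale[OF sub])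
    then show ?thesis
      using \<open>f c \<noteq> 0\<close> by simp
  qed
qed

lemma class_op_comp:
  assumes "finite X"
  shows "class_op X cls c1 \<circ> class_op X cls c2 =
    kop X (\<lambda>y x. of_nat (card {z \<in> X. cls y z = c1 \<and> cls z x = c2}))"
proof -
  have "(\<Sum>z\<in>X. of_bool (cls y z = c1) * of_bool (cls z x = c2)) =
      (of_nat (card {z \<in> X. cls y z = c1 \<and> cls z x = c2}) :: complex)" for y x
  proof -
    have "(\<Sum>z\<in>X. of_bool (cls y z = c1) * of_bool (cls z x = c2)) =
        (\<Sum>z\<in>X. if cls y z = c1 \<and> cls z x = c2 then 1 else (0::complex))"
      by (intro sum.cong) auto
    then show ?thesis
      using assms by (simp add: sum.inter_filter[symmetric])
  qed
  then show ?thesis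
    unfolding class_op_def kop_comp by presburger
qed

text \<open>The entries of a product of indicators count intermediate points \<open>z\<close>. Hence
  it suffices to know which classes are reached; the multiplicities need not be computed.\<close>

lemma class_op_mem_product:
  assumes "finite X" and S: "is_subalgebra X S" "S \<subseteq> class_ops X cls"
    and "class_op X cls c1 \<in> S" "class_op X cls c2 \<in> S"
    and ex: "\<And>y x. y \<in> X \<Longrightarrow> x \<in> X \<Longrightarrow> cls y x = c \<Longrightarrow> \<exists>z\<in>X. cls y z = c1 \<and> cls z x = c2"
    and supp: "\<And>y z x. y \<in> X \<Longrightarrow> z \<in> X \<Longrightarrow> x \<in> X \<Longrightarrow> cls y z = c1 \<Longrightarrow> cls z x = c2 \<Longrightarrow>
      cls y x \<noteq> c \<Longrightarrow> class_op X cls (cls y x) \<in> S"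
  shows "class_op X cls c \<in> S"
proof (rule class_op_mem_triangular[OF assms(1) S])
  show "kop X (\<lambda>y x. of_nat (card {z \<in> X. cls y z = c1 \<and> cls z x = c2})) \<in> S"
    using assms(4,5) S unfolding class_op_comp[OF assms(1), symmetric] is_subalgebra_def by blast
  show "of_nat (card {z \<in> X. cls y z = c1 \<and> cls z x = c2}) \<noteq> (0::complex)"
    if "y \<in> X" "x \<in> X" "cls y x = c" for y x
    using ex[OF that] assms(1) by (auto simp: card_eq_0_iff)
  show "class_op X cls (cls y x) \<in> S"
    if "y \<in> X" "x \<in> X" "of_nat (card {z \<in> X. cls y z = c1 \<and> cls z x = c2}) \<noteq> (0::complex)"
      "cls y x \<noteq> c" for y x
    using that supp assms(1) by (fastforce simp: card_eq_0_iff)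
qed

section \<open>Pairs of subsets\<close>

text \<open>The distance from being nested: the number of elements of the smaller set to be
  exchanged before it lies in the larger one. For sets of equal size it is the distance in a Johnson
  graph.\<close>

definition sdist :: "'a set \<Rightarrow> 'a set \<Rightarrow> nat"
  where "sdist A B = min (card (A - B)) (card (B - A))"

lemma sdist_commute: "sdist A B = sdist B A"
  by (simp add: sdist_def min.commute)

lemma card_diff_swap:
  assumes "finite A" "finite B"
  shows "card (A - B) + card B = card (B - A) + card A"
  using card_Un_disjoint[of "A - B" B] card_Un_disjoint[of "B - A" A] assms
  by (simp add: Un_commute Diff_disjoint Int_commute)

lemma sdist_cases:
  assumes "finite A" "finite B"
  shows "card (A - B) = sdist A B + (card A - card B)" "card (B - A) = sdist A B + (card B - card A)"
  using card_diff_swap[OF assms] by (auto simp: sdist_def)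

lemma sdist_eq_0_iff:
  assumes "finite A" "finite B" "card A \<le> card B"
  shows "sdist A B = 0 \<longleftrightarrow> A \<subseteq> B"
proof -
  have "sdist A B = card (A - B)"
    using sdist_cases(1)[OF assms(1,2)] assms(3) by simp
  then show ?thesis
    using assms by (simp add: card_eq_0_iff)
qed

text \<open>The size condition matters: an empty \<open>C\<close> would have \<open>sdist\<close> 0
  to every set. With \<open>card A = card C\<close> the two differences of \<open>A\<close> and
  \<open>C\<close> have the same size, so the triangle inequalities for both one-sided differences
  involve the same first term.\<close>

lemma sdist_triangle:
  assumes "finite A" "finite B" "finite C" "card A = card C"
  shows "sdist A B \<le> sdist A C + sdist C B"
proof -
  have "card (A - B) \<le> card (A - C) + card (C - B)"
    by (rule order_trans[OF card_mono card_Un_le]) (use assms in auto)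
  moreover have "card (B - A) \<le> card (C - A) + card (B - C)"
    by (rule order_trans[OF card_mono card_Un_le]) (use assms in auto)
  ultimately show ?thesis
    using sdist_cases[of A C] assms unfolding sdist_def[of A B] sdist_def[of C B] by simp
qed

lemma sdist_decrease:
  assumes "finite A" "finite B" "0 < sdist A B"
  shows "\<exists>C. C \<subseteq> A \<union> B \<and> card C = card A \<and> sdist A C = 1 \<and> sdist C B = sdist A B - 1"
proof -
  have "A - B \<noteq> {}" "B - A \<noteq> {}"
    using assms(3) unfolding sdist_def by (metis card.empty less_numeral_extra(3) min_0L min_0R)+
  then obtain e f where ef: "e \<in> A" "e \<notin> B" "f \<in> B" "f \<notin> A"
    by auto
  define C where "C = insert f (A - {e})"
  have sets: "A - C = {e}" "C - A = {f}" "C - B = (A - B) - {e}" "B - C = (B - A) - {f}"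
    using ef by (auto simp: C_def)
  have "sdist C B = sdist A B - 1"
    using ef assms(1,2) by (auto simp: sdist_def sets)
  moreover have "card C = card A"
    using ef assms(1) card_Suc_Diff1[of A e] by (simp add: C_def card_insert_if)
  moreover have "sdist A C = 1"
    by (simp add: sdist_def sets)
  moreover have "C \<subseteq> A \<union> B"
    using ef by (auto simp: C_def)
  ultimately show ?thesis
    by blast
qed

text \<open>Fibres of the two labellings over the same label have equal size; bijections between
  them are glued together.\<close>

lemma exists_bij_betw_labels:
  assumes "finite S" "\<And>t. card {w \<in> S. l w = t} = card {w \<in> S. l' w = t}"
  shows "\<exists>g. bij_betw g S S \<and> (\<forall>w\<in>S. l' (g w) = l w)"
proof -
  have "\<exists>h. bij_betw h {w \<in> S. l w = t} {w \<in> S. l' w = t}" for t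
    using assms by (intro finite_same_card_bij) auto
  then obtain h where h: "\<And>t. bij_betw (h t) {w \<in> S. l w = t} {w \<in> S. l' w = t}"
    by metis
  define g where "g w = h (l w) w" for w
  have img: "g w \<in> S \<and> l' (g w) = l w" if "w \<in> S" for w
    using bij_betwE[OF h[of "l w"]] that by (auto simp: g_def)
  have "inj_on g S"
  proof (rule inj_onI)
    fix v w assume vw: "v \<in> S" "w \<in> S" "g v = g w"
    then have "l v = l w"
      using img by metis
    then show "v = w"
      using vw h[of "l w"] by (auto simp: g_def bij_betw_def inj_on_def)
  qed
  moreover have "g ` S \<subseteq> S"
    using img by auto
  ultimately have "bij_betw g S S"
    using assms(1) by (simp add: bij_betw_def endo_inj_surj)
  then show ?thesis
    using img by auto
qed

text \<open>The two sizes together with \<open>sdist\<close> determine the sizes of all four cells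
  of the Venn diagram. Label each point by its cell.\<close>

lemma exists_bij_betw_pair:
  assumes "finite S" "A \<subseteq> S" "B \<subseteq> S" "A' \<subseteq> S" "B' \<subseteq> S"
    and "card A = card A'" "card B = card B'" "sdist A B = sdist A' B'"
  shows "\<exists>g. bij_betw g S S \<and> g ` A = A' \<and> g ` B = B'"
proof -
  have fin: "finite A" "finite B" "finite A'" "finite B'"
    using assms finite_subset by metis+
  have d: "card (A - B) = card (A' - B')" "card (B - A) = card (B' - A')"
    using sdist_cases[OF fin(1,2)] sdist_cases[OF fin(3,4)] assms by auto
  moreover have i: "card (A \<inter> B) = card (A' \<inter> B')"
    using card_Int_Diff[OF fin(1), of B] card_Int_Diff[OF fin(3), of B'] d assms by auto
  moreover have "card (S - (A \<union> B)) = card (S - (A' \<union> B'))"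
    using card_Un_Int[OF fin(1,2)] card_Un_Int[OF fin(3,4)] i assms fin
    by (simp add: card_Diff_subset)
  moreover have
    "{w \<in> S. (w \<in> A, w \<in> B) = t} = (if fst t then if snd t then A \<inter> B else A - B
       else if snd t then B - A else S - (A \<union> B))" for t
    using assms(2,3) by (cases t) auto
  moreover have
    "{w \<in> S. (w \<in> A', w \<in> B') = t} = (if fst t then if snd t then A' \<inter> B' else A' - B'
       else if snd t then B' - A' else S - (A' \<union> B'))" for t
    using assms(4,5) by (cases t) auto
  ultimately have "card {w \<in> S. (w \<in> A, w \<in> B) = t} = card {w \<in> S. (w \<in> A', w \<in> B') = t}" for t
    by presburger
  then obtain g where g: "bij_betw g S S"
    "\<And>w. w \<in> S \<Longrightarrow> (g w \<in> A', g w \<in> B') = (w \<in> A, w \<in> B)"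
    using exists_bij_betw_labels[OF assms(1), of "\<lambda>w. (w \<in> A, w \<in> B)" "\<lambda>w. (w \<in> A', w \<in> B')"]
    by blast
  have "g ` C = C'" if "C \<subseteq> S" "C' \<subseteq> S" "\<And>w. w \<in> S \<Longrightarrow> g w \<in> C' \<longleftrightarrow> w \<in> C" for C C'
  proof -
    have "\<exists>w\<in>C. v = g w" if "v \<in> C'" for v
      using g(1) that \<open>C' \<subseteq> S\<close> \<open>\<And>w. w \<in> S \<Longrightarrow> g w \<in> C' \<longleftrightarrow> w \<in> C\<close>
      by (metis bij_betw_imp_surj_on imageE subsetD)
    then show ?thesis
      using that by auto
  qed
  then show ?thesis
    using g assms by (intro exI[of _ g]) auto
qed

lemma sdist_le_depth:
  assumes "finite S" "A \<subseteq> S" "B \<subseteq> S"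
  shows "sdist A B \<le> depth (card S) (card A) (card B)"
proof -
  have fin: "finite A" "finite B"
    using assms finite_subset by metis+
  have "card (A - B) \<le> card A" "card (B - A) \<le> card B"
    "card (A - B) \<le> card (S - B)" "card (B - A) \<le> card (S - A)"
    using assms fin by (auto intro!: card_mono)
  then show ?thesis
    using assms fin by (auto simp: sdist_def depth_def card_Diff_subset)
qed

lemma exists_pair_sdist:
  assumes "finite S" "a \<le> card S" "b \<le> card S" "i \<le> depth (card S) a b"
  shows "\<exists>A B. A \<subseteq> S \<and> B \<subseteq> S \<and> card A = a \<and> card B = b \<and> sdist A B = i"
proof -
  have *: "\<exists>A B. A \<subseteq> S \<and> B \<subseteq> S \<and> card A = a \<and> card B = b \<and> sdist A B = i"
    if ab: "a \<le> b" "b \<le> card S" "i \<le> a" "i + b \<le> card S" for a b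
  proof -
    obtain A where A: "A \<subseteq> S" "card A = a" "finite A"
      using obtain_subset_with_card_n[of a S] ab by auto
    obtain I where I: "I \<subseteq> A" "card I = a - i" "finite I"
      using obtain_subset_with_card_n[of "a - i" A] A by auto
    \<comment> \<open>The second set keeps \<open>a - i\<close> points of the first and takes the
      rest from outside; the assumption \<open>i + b <= card S\<close> leaves enough room.\<close>
    have "card (S - A) = card S - a"
      using A by (simp add: card_Diff_subset)
    then obtain J where J: "J \<subseteq> S - A" "card J = b - (a - i)" "finite J"
      using obtain_subset_with_card_n[of "b - (a - i)" "S - A"] ab by force
    have sets: "A - (I \<union> J) = A - I" "(I \<union> J) - A = J"
      using I J by auto
    have "card (I \<union> J) = b"
      using I J ab by (subst card_Un_disjoint) auto
    moreover have "sdist A (I \<union> J) = i"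
      using I J A ab by (simp add: sdist_def sets card_Diff_subset)
    ultimately show ?thesis
      using A I J by (intro exI[of _ A] exI[of _ "I \<union> J"]) auto
  qed
  show ?thesis
  proof (cases "a \<le> b")
    case True
    then show ?thesis
      using *[of a b] assms by (auto simp: depth_def)
  next
    case False
    then have "b \<le> a" "a \<le> card S" "i \<le> b" "i + a \<le> card S"
      using assms by (auto simp: depth_def)
    from *[OF this] show ?thesis
      by (metis sdist_commute)
  qed
qed

lemma depth_reflect: "p \<le> n \<Longrightarrow> q \<le> n \<Longrightarrow> depth n (n - p) (n - q) = depth n p q"
  by (simp add: depth_def min.commute)

lemma card_supersets:
  assumes "finite S" "W \<subseteq> S" "card W \<le> m"
  shows "card {B. W \<subseteq> B \<and> B \<subseteq> S \<and> card B = m} = (card S - card W) choose (m - card W)"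
proof -
  have fin: "finite W"
    using assms finite_subset by blast
  have "bij_betw (\<lambda>B. B - W) {B. W \<subseteq> B \<and> B \<subseteq> S \<and> card B = m}
      {C. C \<subseteq> S - W \<and> card C = m - card W}"
  proof (rule bij_betw_byWitness[where f' = "\<lambda>C. C \<union> W"])
    show "(\<lambda>C. C \<union> W) ` {C. C \<subseteq> S - W \<and> card C = m - card W} \<subseteq>
        {B. W \<subseteq> B \<and> B \<subseteq> S \<and> card B = m}"
    proof clarify
      fix C assume "C \<subseteq> S - W" "card C = m - card W"
      moreover from this have "card (C \<union> W) = card C + card W"
        using fin assms(1) by (intro card_Un_disjoint) (auto dest: finite_subset)
      ultimately show "W \<subseteq> C \<union> W \<and> C \<union> W \<subseteq> S \<and> card (C \<union> W) = m"
        using assms by auto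
    qed
  qed (use fin in \<open>auto simp: card_Diff_subset\<close>)
  then have "card {B. W \<subseteq> B \<and> B \<subseteq> S \<and> card B = m} = card {C. C \<subseteq> S - W \<and> card C = m - card W}"
    by (rule bij_betw_same_card)
  also have "\<dots> = (card S - card W) choose (m - card W)"
    using assms fin by (simp add: n_subsets card_Diff_subset)
  finally show ?thesis .
qed

section \<open>Invariance of the Terwilliger algebra\<close>

locale johnson =
  fixes \<Omega> :: "'a set" and k :: nat and x0 :: "'a set"
  assumes finite_\<Omega>: "finite \<Omega>" and k_pos: "0 < k" and k_less: "k < card \<Omega>"
    and x0: "x0 \<in> nsets \<Omega> k"
begin

abbreviation X where "X \<equiv> nsets \<Omega> k"
abbreviation T where "T \<equiv> terwilliger_algebra \<Omega> k x0"

text \<open>For a vertex \<open>x\<close> this is its distance from \<open>x0\<close> in the Johnson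
  graph.\<close>

definition lev :: "'a set \<Rightarrow> nat"
  where "lev x = card (x - x0)"

text \<open>The level of the column index \<open>x\<close> comes first, so a label
  \<open>(p, q, i, j)\<close> belongs to the block that maps level \<open>p\<close> to level
  \<open>q\<close>.\<close>

definition cls :: "'a set \<Rightarrow> 'a set \<Rightarrow> nat \<times> nat \<times> nat \<times> nat"
  where "cls y x = (lev x, lev y, sdist (y \<inter> x0) (x \<inter> x0), sdist (y - x0) (x - x0))"

definition scls :: "'a set \<Rightarrow> 'a set \<Rightarrow> nat \<times> nat \<times> nat \<times> nat"
  where "scls y x = (case cls y x of (p, q, i, j) \<Rightarrow> (p, q, min i j, max i j))"

lemma x0_props: "x0 \<subseteq> \<Omega>" "finite x0" "card x0 = k" "finite (\<Omega> - x0)" "card (\<Omega> - x0) = card \<Omega> - k"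
  using x0 finite_\<Omega> by (auto simp: nsets_def card_Diff_subset)

lemma finite_X: "finite X"
  using finite_\<Omega> by (rule finite_imp_finite_nsets)

lemma X_props:
  assumes "x \<in> X"
  shows "x \<subseteq> \<Omega>" "finite x" "card x = k" "finite (x \<inter> x0)" "finite (x - x0)"
    "card (x \<inter> x0) + lev x = k" "card (x \<inter> x0) = k - lev x" "lev x \<le> k" "lev x \<le> card \<Omega> - k"
proof -
  show *: "x \<subseteq> \<Omega>" "finite x" "card x = k" "finite (x \<inter> x0)" "finite (x - x0)"
    using assms by (auto simp: nsets_def)
  show **: "card (x \<inter> x0) + lev x = k"
    unfolding lev_def using card_Int_Diff[OF *(2), of x0] *(3) by simp
  then show "card (x \<inter> x0) = k - lev x" "lev x \<le> k"
    by auto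
  show "lev x \<le> card \<Omega> - k"
    unfolding lev_def x0_props(5)[symmetric] using *(1) x0_props by (intro card_mono) auto
qed

lemma exists_join:
  assumes "A \<subseteq> x0" "B \<subseteq> \<Omega> - x0" "card A + card B = k"
  shows "A \<union> B \<in> X" "(A \<union> B) \<inter> x0 = A" "(A \<union> B) - x0 = B" "lev (A \<union> B) = card B"
proof -
  have "finite A" "finite B"
    using assms x0_props finite_subset by metis+
  then have "card (A \<union> B) = k"
    using assms by (subst card_Un_disjoint) auto
  then show "A \<union> B \<in> X" "(A \<union> B) \<inter> x0 = A" "(A \<union> B) - x0 = B"
    using assms x0_props \<open>finite A\<close> \<open>finite B\<close> by (auto simp: nsets_def)
  then show "lev (A \<union> B) = card B"
    by (simp add: lev_def)
qed

lemma card_x0_diff: "x \<in> X \<Longrightarrow> card (x0 - x) = lev x"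
  using card_diff_swap[of x x0] X_props[of x] x0_props by (simp add: lev_def)

text \<open>Splitting \<open>x - y\<close> along \<open>x0\<close> shows that its size is the sum of
  the two exchange numbers and the difference of the levels; adjacency means that this sum is
  1.\<close>

lemma card_Int_eq_iff:
  assumes "x \<in> X" "y \<in> X"
  shows "card (x \<inter> y) = k - 1 \<longleftrightarrow>
    lev x = lev y \<and> sdist (y \<inter> x0) (x \<inter> x0) + sdist (y - x0) (x - x0) = 1 \<or>
    (lev y = Suc (lev x) \<or> lev x = Suc (lev y)) \<and>
      sdist (y \<inter> x0) (x \<inter> x0) = 0 \<and> sdist (y - x0) (x - x0) = 0"
proof -
  note px = X_props[OF assms(1)] and py = X_props[OF assms(2)]
  have "card (x - y) = card ((x \<inter> x0 - y \<inter> x0) \<union> ((x - x0) - (y - x0)))"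
    by (rule arg_cong[of _ _ card]) auto
  also have "\<dots> = card (x \<inter> x0 - y \<inter> x0) + card ((x - x0) - (y - x0))"
    using px by (intro card_Un_disjoint) auto
  finally have "card (x - y) = card (x \<inter> x0 - y \<inter> x0) + card ((x - x0) - (y - x0))" .
  moreover have "card (x \<inter> y) + card (x - y) = k"
    using card_Int_Diff[OF px(2), of y] px(3) by simp
  moreover have "card (x \<inter> x0 - y \<inter> x0) = sdist (y \<inter> x0) (x \<inter> x0) + (lev y - lev x)"
    using sdist_cases(2)[OF py(4) px(4)] px(6) py(6) by simp
  moreover have "card ((x - x0) - (y - x0)) = sdist (y - x0) (x - x0) + (lev x - lev y)"
    using sdist_cases(2)[OF py(5) px(5)] by (simp add: lev_def)
  ultimately show ?thesis
    using k_pos by linarith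
qed

lemma adj_op_eq_kop: "adj_op \<Omega> k = kop X (\<lambda>y x. of_bool (card (x \<inter> y) = k - 1))"
proof -
  have "(\<Sum>y' | y' \<in> X \<and> card (x \<inter> y') = k - 1. bvec y') y = of_bool (card (x \<inter> y) = k - 1)"
    if "y \<in> X" for x y
    using that finite_X by (simp add: sum_fun_apply bvec_def)
  then show ?thesis
    unfolding adj_op_def
    by (subst lin_ext_eq_kop) (auto intro!: cspace_sum bvec_in_cspace kop_cong)
qed

definition dual_eigenvalue :: "nat \<Rightarrow> complex"
  where "dual_eigenvalue p = (of_nat (card \<Omega>) - 1) *
    (1 - of_nat (card \<Omega>) * of_nat (2 * p) / (2 * of_nat k * (of_nat (card \<Omega>) - of_nat k)))"

text \<open>The eigenvalue is affine in the level, and its slope is nonzero because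
  \<open>0 < k < D\<close> forces \<open>D >= 2\<close>.\<close>

lemma inj_dual_eigenvalue: "dual_eigenvalue p = dual_eigenvalue q \<longleftrightarrow> p = q"
proof -
  have "of_nat (card \<Omega>) - 1 \<noteq> (0::complex)" "of_nat (card \<Omega>) \<noteq> (0::complex)"
    "of_nat k \<noteq> (0::complex)" "of_nat (card \<Omega>) - of_nat k \<noteq> (0::complex)"
    using k_pos k_less by simp_all
  then show ?thesis
    by (simp add: dual_eigenvalue_def)
qed

lemma dual_adj_op_eq_kop:
  "dual_adj_op \<Omega> k x0 = kop X (\<lambda>y x. if y = x then dual_eigenvalue (lev x) else 0)"
proof -
  have card: "card (x0 - x) + card (x - x0) = 2 * lev x" if "x \<in> X" for x
    using card_x0_diff[OF that] by (simp add: lev_def)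
  show ?thesis
    unfolding dual_adj_op_def
  proof (rule trans[OF lin_ext_eq_kop])
    fix x assume "x \<in> X"
    then show "vscale ((of_nat (card \<Omega>) - 1) * (1 - of_nat (card \<Omega>) *
        of_nat (card (x0 - x) + card (x - x0)) / (2 * of_nat k * (of_nat (card \<Omega>) - of_nat k))))
        (bvec x) \<in> cspace X"
      by (intro vscale_in_cspace bvec_in_cspace)
  qed (rule kop_cong, simp add: vscale_def bvec_def dual_eigenvalue_def card)
qed

lemma T_subalgebra: "is_subalgebra X T"
  by (rule is_subalgebra_terwilliger_algebra)

lemma T_subspace: "oper.subspace T"
  using T_subalgebra by (simp add: is_subalgebra_def)

lemma T_comp: "F \<in> T \<Longrightarrow> H \<in> T \<Longrightarrow> F \<circ> H \<in> T"
  using T_subalgebra by (simp add: is_subalgebra_def)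

lemma adj_op_in_T: "adj_op \<Omega> k \<in> T" and dual_adj_op_in_T: "dual_adj_op \<Omega> k x0 \<in> T"
  unfolding terwilliger_algebra_def by (auto intro: hull_inc)

text \<open>Invariance need only be checked on the two generators. The maps in \<open>G\<close> act
  on vertices and need not be induced by permutations of \<Omega>, so that complementation is
  covered.\<close>

lemma T_subset_invariant_ops:
  assumes bij: "\<And>g. g \<in> G \<Longrightarrow> bij_betw g X X"
    and int: "\<And>g y x. g \<in> G \<Longrightarrow> y \<in> X \<Longrightarrow> x \<in> X \<Longrightarrow> card (g x \<inter> g y) = card (x \<inter> y)"
    and lev: "\<And>g x. g \<in> G \<Longrightarrow> x \<in> X \<Longrightarrow> lev (g x) = lev x"
  shows "T \<subseteq> invariant_ops X G"
proof -
  have inj: "g y = g x \<longleftrightarrow> y = x" if "g \<in> G" "y \<in> X" "x \<in> X" for g x y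
    using bij[OF that(1)] that by (auto simp: bij_betw_def inj_on_def)
  have "adj_op \<Omega> k \<in> invariant_ops X G"
    unfolding adj_op_eq_kop by (rule kop_invariantI) (simp add: int)
  moreover have "dual_adj_op \<Omega> k x0 \<in> invariant_ops X G"
    unfolding dual_adj_op_eq_kop by (rule kop_invariantI) (simp add: lev inj)
  ultimately show ?thesis
    unfolding terwilliger_algebra_def
    by (intro hull_minimal is_subalgebra_invariant_ops bij) auto
qed

definition stabilizer :: "('a set \<Rightarrow> 'a set) set"
  where "stabilizer = {image g | g. bij_betw g \<Omega> \<Omega> \<and> g ` x0 = x0}"

lemma bij_betw_image_nsets:
  assumes "bij_betw g \<Omega> \<Omega>"
  shows "bij_betw (image g) X X"
proof -
  have inj: "inj_on g \<Omega>" and img: "g ` \<Omega> = \<Omega>"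
    using assms by (auto simp: bij_betw_def)
  have "inj_on (image g) X"
    using inj by (intro inj_onI) (auto simp: nsets_def inj_on_image_eq_iff)
  moreover have "image g ` X \<subseteq> X"
    using inj img by (auto simp: nsets_def card_image inj_on_subset)
  ultimately show ?thesis
    using finite_X by (simp add: bij_betw_def endo_inj_surj)
qed

lemma T_subset_stabilizer_invariant: "T \<subseteq> invariant_ops X stabilizer"
proof (rule T_subset_invariant_ops)
  fix h assume "h \<in> stabilizer"
  then obtain g where g: "h = image g" "bij_betw g \<Omega> \<Omega>" "g ` x0 = x0"
    by (auto simp: stabilizer_def)
  have inj: "inj_on g \<Omega>"
    using g by (simp add: bij_betw_def)
  show "bij_betw h X X"
    using g bij_betw_image_nsets by simp
  show "card (h x \<inter> h y) = card (x \<inter> y)" if "y \<in> X" "x \<in> X" for x y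
  proof -
    have "h x \<inter> h y = g ` (x \<inter> y)"
      using inj_on_image_Int[OF inj] X_props(1) that by (simp add: g)
    then show ?thesis
      using inj X_props(1)[OF that(1)] by (simp add: card_image inj_on_subset le_infI2)
  qed
  show "lev (h x) = lev x" if "x \<in> X" for x
  proof -
    have "h x - x0 = g ` (x - x0)"
      using inj_on_image_set_diff[OF inj, of x x0] X_props(1)[OF that] x0_props(1) g
      by (simp add: Diff_subset subset_trans[OF Diff_subset])
    then show ?thesis
      using inj X_props(1)[OF that] by (simp add: lev_def card_image inj_on_subset le_infI2 subset_trans[OF Diff_subset])
  qed
qed

text \<open>Inside and outside \<open>x0\<close> the two pairs can be matched independently by
  \<open>exists_bij_betw_pair\<close>; the two permutations combine to one that fixes
  \<open>x0\<close> as a set.\<close>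

lemma cls_transitive:
  assumes "y \<in> X" "x \<in> X" "y' \<in> X" "x' \<in> X" "cls y x = cls y' x'"
  shows "\<exists>h\<in>stabilizer. h y = y' \<and> h x = x'"
proof -
  note p = X_props[OF assms(1)] X_props[OF assms(2)] X_props[OF assms(3)] X_props[OF assms(4)]
  have c: "lev x = lev x'" "lev y = lev y'" "sdist (y \<inter> x0) (x \<inter> x0) = sdist (y' \<inter> x0) (x' \<inter> x0)"
    "sdist (y - x0) (x - x0) = sdist (y' - x0) (x' - x0)"
    using assms(5) by (auto simp: cls_def)
  obtain g1 where g1: "bij_betw g1 x0 x0" "g1 ` (y \<inter> x0) = y' \<inter> x0" "g1 ` (x \<inter> x0) = x' \<inter> x0"
    using exists_bij_betw_pair[of x0 "y \<inter> x0" "x \<inter> x0" "y' \<inter> x0" "x' \<inter> x0"] x0_props p c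
    by auto
  have "\<exists>g. bij_betw g (\<Omega> - x0) (\<Omega> - x0) \<and> g ` (y - x0) = y' - x0 \<and> g ` (x - x0) = x' - x0"
    by (rule exists_bij_betw_pair)
      (use x0_props(4) X_props(1) assms(1-4) c in \<open>auto simp: lev_def[symmetric]\<close>)
  then obtain g2 where g2: "bij_betw g2 (\<Omega> - x0) (\<Omega> - x0)" "g2 ` (y - x0) = y' - x0"
    "g2 ` (x - x0) = x' - x0"
    by blast
  define g where "g w = (if w \<in> x0 then g1 w else g2 w)" for w
  have img: "g ` z = g1 ` (z \<inter> x0) \<union> g2 ` (z - x0)" for z
    by (auto simp: g_def image_iff)
  have b1: "bij_betw g x0 x0"
    using g1(1) by (rule bij_betw_cong[THEN iffD1, rotated]) (simp add: g_def)
  have b2: "bij_betw g (\<Omega> - x0) (\<Omega> - x0)"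
    using g2(1) by (rule bij_betw_cong[THEN iffD1, rotated]) (simp add: g_def)
  have "bij_betw g (x0 \<union> (\<Omega> - x0)) (x0 \<union> (\<Omega> - x0))"
    by (rule bij_betw_combine[OF b1 b2]) auto
  moreover have "g ` x0 = x0"
    using b1 by (simp add: bij_betw_def)
  moreover have "x0 \<union> (\<Omega> - x0) = \<Omega>"
    using x0_props by auto
  moreover have "g ` y = y'" "g ` x = x'"
    using g1 g2 by (auto simp: img)
  ultimately show ?thesis
    by (auto simp: stabilizer_def)
qed

lemma T_subset_class_ops: "T \<subseteq> class_ops X cls"
proof (rule subset_trans[OF T_subset_stabilizer_invariant invariant_ops_subset_class_ops])
  fix K :: "'a set \<Rightarrow> 'a set \<Rightarrow> complex" and y x y' x'
  assume K: "\<And>g y x. g \<in> stabilizer \<Longrightarrow> y \<in> X \<Longrightarrow> x \<in> X \<Longrightarrow> K (g y) (g x) = K y x"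
    and m: "y \<in> X" "x \<in> X" "y' \<in> X" "x' \<in> X" "cls y x = cls y' x'"
  from cls_transitive[OF m] obtain h where "h \<in> stabilizer" "h y = y'" "h x = x'"
    by blast
  then show "K y x = K y' x'"
    using K[of h y x] m by simp
qed

text \<open>For \<open>D = 2 k\<close> complementation preserves intersection sizes but sends level
  \<open>p\<close> to \<open>k - p\<close>. A permutation exchanging \<open>x0\<close> with its
  complement repairs the level, and the composite interchanges inner and outer exchange
  numbers.\<close>

lemma T_subset_sym_class_ops:
  assumes D: "card \<Omega> = 2 * k"
  shows "T \<subseteq> class_ops X scls"
proof -
  have "\<exists>g. bij_betw g x0 (\<Omega> - x0)" "\<exists>g. bij_betw g (\<Omega> - x0) x0"
    using D x0_props by (auto intro!: finite_same_card_bij)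
  then obtain g1 g2 where g12: "bij_betw g1 x0 (\<Omega> - x0)" "bij_betw g2 (\<Omega> - x0) x0"
    by blast
  define g where "g w = (if w \<in> x0 then g1 w else g2 w)" for w
  have g0: "bij_betw g x0 (\<Omega> - x0)"
    using g12(1) by (rule bij_betw_cong[THEN iffD1, rotated]) (simp add: g_def)
  have g1: "bij_betw g (\<Omega> - x0) x0"
    using g12(2) by (rule bij_betw_cong[THEN iffD1, rotated]) (simp add: g_def)
  have "bij_betw g (x0 \<union> (\<Omega> - x0)) ((\<Omega> - x0) \<union> x0)"
    by (rule bij_betw_combine[OF g0 g1]) auto
  moreover have "x0 \<union> (\<Omega> - x0) = \<Omega>" "(\<Omega> - x0) \<union> x0 = \<Omega>"
    using x0_props by auto
  ultimately have bij: "bij_betw g \<Omega> \<Omega>"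
    by simp
  then have inj: "inj_on g \<Omega>" and img: "g ` \<Omega> = \<Omega>"
    by (auto simp: bij_betw_def)
  have imgs: "g ` x0 = \<Omega> - x0" "g ` (\<Omega> - x0) = x0"
    using g0 g1 by (auto simp: bij_betw_def)
  define h where "h x = g ` (\<Omega> - x)" for x
  have h_Int: "h x \<inter> x0 = g ` ((\<Omega> - x0) - (x - x0))"
    and h_Diff: "h x - x0 = g ` (x0 - x)" for x
  proof -
    have "h x \<inter> g ` (\<Omega> - x0) = g ` ((\<Omega> - x) \<inter> (\<Omega> - x0))"
      unfolding h_def by (rule inj_on_image_Int[OF inj, symmetric]) auto
    moreover have "(\<Omega> - x) \<inter> (\<Omega> - x0) = (\<Omega> - x0) - (x - x0)"
      by auto
    ultimately show "h x \<inter> x0 = g ` ((\<Omega> - x0) - (x - x0))"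
      using imgs by simp
    have "h x - g ` (\<Omega> - x0) = g ` ((\<Omega> - x) - (\<Omega> - x0))"
      unfolding h_def by (rule inj_on_image_set_diff[OF inj, symmetric]) auto
    moreover have "(\<Omega> - x) - (\<Omega> - x0) = x0 - x"
      using x0_props by auto
    ultimately show "h x - x0 = g ` (x0 - x)"
      using imgs by simp
  qed
  have card_g: "card (g ` A) = card A" if "A \<subseteq> \<Omega>" for A
    using that inj by (simp add: card_image inj_on_subset)
  have sdist_g: "sdist (g ` A) (g ` B) = sdist A B" if "A \<subseteq> \<Omega>" "B \<subseteq> \<Omega>" for A B
  proof -
    have "g ` A - g ` B = g ` (A - B)" "g ` B - g ` A = g ` (B - A)"
      using inj_on_image_set_diff[OF inj, of A B] inj_on_image_set_diff[OF inj, of B A] that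
      by (simp_all add: subset_trans[OF Diff_subset])
    then show ?thesis
      using that by (simp add: sdist_def card_g subset_trans[OF Diff_subset])
  qed
  have sdist_compl: "sdist (S - A) (S - B) = sdist A B" if "A \<subseteq> S" "B \<subseteq> S" for A B S :: "'a set"
  proof -
    have "(S - A) - (S - B) = B - A" "(S - B) - (S - A) = A - B"
      using that by auto
    then show ?thesis
      by (simp add: sdist_def min.commute)
  qed
  have lev_h: "lev (h x) = lev x" if "x \<in> X" for x
  proof -
    have "lev (h x) = card (x0 - x)"
      unfolding lev_def h_Diff using x0_props by (intro card_g) auto
    then show ?thesis
      using card_x0_diff[OF that] by simp
  qed
  have h_bij: "bij_betw h X X"
  proof -
    have "inj_on h X"
    proof (rule inj_onI)
      fix x y assume xy: "x \<in> X" "y \<in> X" "h x = h y"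
      then have "\<Omega> - x = \<Omega> - y"
        using inj_on_image_eq_iff[OF inj] by (simp add: h_def)
      then show "x = y"
        using X_props(1) xy by blast
    qed
    moreover have "h ` X \<subseteq> X"
    proof (rule image_subsetI)
      fix x assume "x \<in> X"
      note px = X_props[OF this]
      have "card (h x) = k"
        unfolding h_def using px D by (subst card_g) (auto simp: card_Diff_subset)
      moreover have "h x \<subseteq> \<Omega>"
        unfolding h_def using img by blast
      ultimately show "h x \<in> X"
        using finite_\<Omega> finite_subset by (auto simp: nsets_def)
    qed
    ultimately show ?thesis
      using finite_X by (simp add: bij_betw_def endo_inj_surj)
  qed
  have h_card: "card (h x \<inter> h y) = card (x \<inter> y)" if "x \<in> X" "y \<in> X" for x y
  proof -
    note px = X_props[OF that(1)] X_props[OF that(2)]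
    have "h x \<inter> h y = g ` ((\<Omega> - x) \<inter> (\<Omega> - y))"
      unfolding h_def by (rule inj_on_image_Int[OF inj, symmetric]) auto
    then have "card (h x \<inter> h y) = card ((\<Omega> - x) \<inter> (\<Omega> - y))"
      by (simp add: card_g subset_trans[OF Int_lower1])
    also have "(\<Omega> - x) \<inter> (\<Omega> - y) = \<Omega> - (x \<union> y)"
      by auto
    also have "card \<dots> = 2 * k - card (x \<union> y)"
      using px D by (simp add: card_Diff_subset)
    finally show ?thesis
      using card_Un_Int[of x y] px by simp
  qed
  have cls_h: "cls (h y) (h x) = (lev x, lev y, sdist (y - x0) (x - x0), sdist (y \<inter> x0) (x \<inter> x0))"
    if "x \<in> X" "y \<in> X" for x y
  proof -
    note px = X_props(1)[OF that(1)] X_props(1)[OF that(2)]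
    have "sdist (h y \<inter> x0) (h x \<inter> x0) = sdist (y - x0) (x - x0)"
    proof -
      have "sdist (h y \<inter> x0) (h x \<inter> x0) = sdist ((\<Omega> - x0) - (y - x0)) ((\<Omega> - x0) - (x - x0))"
        unfolding h_Int by (rule sdist_g) auto
      also have "\<dots> = sdist (y - x0) (x - x0)"
        using px by (intro sdist_compl) auto
      finally show ?thesis .
    qed
    moreover have "sdist (h y - x0) (h x - x0) = sdist (y \<inter> x0) (x \<inter> x0)"
    proof -
      have "sdist (h y - x0) (h x - x0) = sdist (x0 - y \<inter> x0) (x0 - x \<inter> x0)"
        unfolding h_Diff using x0_props by (subst sdist_g) (auto intro!: arg_cong2[of _ _ _ _ sdist])
      also have "\<dots> = sdist (y \<inter> x0) (x \<inter> x0)"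
        by (intro sdist_compl) auto
      finally show ?thesis .
    qed
    ultimately show ?thesis
      by (simp add: cls_def lev_h that)
  qed
  have "T \<subseteq> invariant_ops X {h}"
    using h_bij h_card lev_h by (intro T_subset_invariant_ops) auto
  \<comment> \<open>The two invariance statements provide separate kernels \<open>K\<close> and
    \<open>L\<close> of the same operator; these agree on pairs from \<open>X\<close>, so
    \<open>K\<close> is invariant under \<open>h\<close> too.\<close>
  have "T \<subseteq> invariant_ops X (insert h stabilizer)"
  proof
    fix F assume F: "F \<in> T"
    obtain K where K: "F = kop X K" "\<And>g y x. g \<in> stabilizer \<Longrightarrow> y \<in> X \<Longrightarrow> x \<in> X \<Longrightarrow> K (g y) (g x) = K y x"
      using F T_subset_stabilizer_invariant unfolding invariant_ops_def by blast
    obtain L where L: "F = kop X L" "\<And>y x. y \<in> X \<Longrightarrow> x \<in> X \<Longrightarrow> L (h y) (h x) = L y x"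
      using F \<open>T \<subseteq> invariant_ops X {h}\<close> unfolding invariant_ops_def by blast
    have "K y x = L y x" if "y \<in> X" "x \<in> X" for y x
      using K(1) L(1) that unfolding K(1) kop_eq_iff[OF finite_X] by blast
    then have "K (h y) (h x) = K y x" if "y \<in> X" "x \<in> X" for y x
      using L(2) that bij_betwE[OF h_bij] by simp
    then show "F \<in> invariant_ops X (insert h stabilizer)"
      unfolding K(1) by (intro kop_invariantI) (use K(2) in auto)
  qed
  then show ?thesis
  proof (rule subset_trans[OF _ invariant_ops_subset_class_ops])
    fix K :: "'a set \<Rightarrow> 'a set \<Rightarrow> complex" and y x y' x'
    assume K: "\<And>g y x. g \<in> insert h stabilizer \<Longrightarrow> y \<in> X \<Longrightarrow> x \<in> X \<Longrightarrow> K (g y) (g x) = K y x"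
      and m: "y \<in> X" "x \<in> X" "y' \<in> X" "x' \<in> X" and eq: "scls y x = scls y' x'"
    have hm: "h y \<in> X" "h x \<in> X"
      using m bij_betwE[OF h_bij] by auto
    \<comment> \<open>Equal symmetrized labels leave two cases: the exchange numbers agree, or they
      agree after the swap made by \<open>h\<close>.\<close>
    have "cls y x = cls y' x' \<or> cls (h y) (h x) = cls y' x'"
      using eq unfolding cls_h[OF m(2,1)] by (auto simp: scls_def cls_def min_def max_def split: if_splits)
    then show "K y x = K y' x'"
    proof
      assume "cls y x = cls y' x'"
      from cls_transitive[OF m this] obtain u where "u \<in> stabilizer" "u y = y'" "u x = x'"
        by blast
      then show ?thesis
        using K[of u y x] m by simp
    next
      assume "cls (h y) (h x) = cls y' x'"
      from cls_transitive[OF hm m(3,4) this]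
      obtain u where "u \<in> stabilizer" "u (h y) = y'" "u (h x) = x'"
        by blast
      then show ?thesis
        using K[of u "h y" "h x"] K[of h y x] m hm by simp
    qed
  qed
qed

section \<open>Generating the class indicators\<close>

lemma diag_comp:
  "kop X (\<lambda>y x. if y = x then f x else 0) \<circ> kop X (\<lambda>y x. if y = x then g x else 0) =
    kop X (\<lambda>y x. if y = x then f x * g x else 0)"
  unfolding kop_comp
proof (rule kop_cong)
  fix y x assume "y \<in> X" "x \<in> X"
  have "(\<Sum>z\<in>X. (if y = z then f z else 0) * (if z = x then g x else 0)) =
      (\<Sum>z\<in>X. if z = y then (if y = x then f x * g x else 0) else 0)"
    by (intro sum.cong) auto
  then show "(\<Sum>z\<in>X. (if y = z then f z else 0) * (if z = x then g x else 0)) =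
      (if y = x then f x * g x else 0)"
    using \<open>y \<in> X\<close> finite_X by simp
qed

text \<open>
  Lagrange interpolation: the dual adjacency operator takes distinct values on distinct levels,
  so the level projections are polynomials in it.
\<close>

lemma level_projection_in_T: "kop X (\<lambda>y x. of_bool (y = x \<and> lev x = p)) \<in> T"
proof -
  let ?diag = "\<lambda>f. kop X (\<lambda>y x. if y = x then f x else 0)"
  have id: "?diag (\<lambda>x. 1) \<in> T"
  proof -
    have "?diag (\<lambda>x. 1) = End_id X"
      unfolding End_id_eq_kop by (rule kop_cong) simp
    then show ?thesis
      using T_subalgebra by (simp add: is_subalgebra_def)
  qed
  have factor: "?diag (\<lambda>x. dual_eigenvalue (lev x) - c) \<in> T" for c
  proof -
    have "dual_adj_op \<Omega> k x0 + opscale (- c) (?diag (\<lambda>x. 1)) \<in> T"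
      by (intro oper.subspace_add[OF T_subspace] oper.subspace_scale[OF T_subspace] id
        dual_adj_op_in_T)
    moreover have "dual_adj_op \<Omega> k x0 + opscale (- c) (?diag (\<lambda>x. 1)) =
        ?diag (\<lambda>x. dual_eigenvalue (lev x) - c)"
      unfolding dual_adj_op_eq_kop opscale_kop kop_add by (rule kop_cong) simp
    ultimately show ?thesis
      by simp
  qed
  have prod: "?diag (\<lambda>x. \<Prod>r\<in>R. dual_eigenvalue (lev x) - dual_eigenvalue r) \<in> T"
    if "finite R" for R
    using that
  proof (induction R)
    case empty
    show ?case
      unfolding prod.empty by (rule id)
  next
    case (insert r R)
    have "?diag (\<lambda>x. dual_eigenvalue (lev x) - dual_eigenvalue r) \<circ>
        ?diag (\<lambda>x. \<Prod>r\<in>R. dual_eigenvalue (lev x) - dual_eigenvalue r) \<in> T"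
      by (intro T_comp factor insert)
    then show ?case
      unfolding diag_comp prod.insert[OF insert(1,2)] .
  qed
  \<comment> \<open>The level \<open>p\<close> is arbitrary. For \<open>p > k\<close> no factor is
    removed and the product vanishes on every level that occurs.\<close>
  define c where "c = (\<Prod>r\<in>{..k} - {p}. dual_eigenvalue p - dual_eigenvalue r)"
  have "c \<noteq> 0"
    by (auto simp: c_def inj_dual_eigenvalue)
  have "opscale (1 / c)
      (?diag (\<lambda>x. \<Prod>r\<in>{..k} - {p}. dual_eigenvalue (lev x) - dual_eigenvalue r)) \<in> T"
    by (intro oper.subspace_scale[OF T_subspace] prod) simp
  moreover have "opscale (1 / c)
      (?diag (\<lambda>x. \<Prod>r\<in>{..k} - {p}. dual_eigenvalue (lev x) - dual_eigenvalue r)) =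
      kop X (\<lambda>y x. of_bool (y = x \<and> lev x = p))"
    unfolding opscale_kop
  proof (rule kop_cong)
    fix y x assume "y \<in> X" "x \<in> X"
    have "(\<Prod>r\<in>{..k} - {p}. dual_eigenvalue (lev x) - dual_eigenvalue r) = c * of_bool (lev x = p)"
    proof (cases "lev x = p")
      case False
      then have "lev x \<in> {..k} - {p}"
        using X_props(8)[OF \<open>x \<in> X\<close>] by simp
      then show ?thesis
        using False by (auto intro!: prod_zero)
    qed (simp add: c_def)
    then show "1 / c * (if y = x then
        \<Prod>r\<in>{..k} - {p}. dual_eigenvalue (lev x) - dual_eigenvalue r else 0) =
        of_bool (y = x \<and> lev x = p)"
      using \<open>c \<noteq> 0\<close> by simp
  qed
  ultimately show ?thesis
    by simp
qed

lemma kop_cut_in_T: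
  assumes "kop X K \<in> T"
  shows "kop X (\<lambda>y x. of_bool (lev x = p \<and> lev y = q) * K y x) \<in> T"
proof -
  have "kop X (\<lambda>y x. of_bool (y = x \<and> lev x = q)) \<circ>
      (kop X K \<circ> kop X (\<lambda>y x. of_bool (y = x \<and> lev x = p))) \<in> T"
    by (intro T_comp level_projection_in_T assms)
  also have "kop X (\<lambda>y x. of_bool (y = x \<and> lev x = q)) \<circ>
      (kop X K \<circ> kop X (\<lambda>y x. of_bool (y = x \<and> lev x = p))) =
      kop X (\<lambda>y x. of_bool (lev x = p \<and> lev y = q) * K y x)"
    unfolding kop_comp
  proof (rule kop_cong)
    fix y x assume m: "y \<in> X" "x \<in> X"
    have inner: "(\<Sum>w\<in>X. K z w * of_bool (w = x \<and> lev x = p)) = K z x * of_bool (lev x = p)" for z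
    proof -
      have "(\<Sum>w\<in>X. K z w * of_bool (w = x \<and> lev x = p)) =
          (\<Sum>w\<in>X. if w = x then K z x * of_bool (lev x = p) else 0)"
        by (intro sum.cong) auto
      then show ?thesis
        using m finite_X by simp
    qed
    have "(\<Sum>z\<in>X. of_bool (y = z \<and> lev z = q) * (K z x * of_bool (lev x = p))) =
        (\<Sum>z\<in>X. if z = y then of_bool (lev x = p \<and> lev y = q) * K y x else 0)"
      by (intro sum.cong) auto
    then show "(\<Sum>z\<in>X. of_bool (y = z \<and> lev z = q) *
        (\<Sum>w\<in>X. K z w * of_bool (w = x \<and> lev x = p))) =
        of_bool (lev x = p \<and> lev y = q) * K y x"
      unfolding inner using m finite_X by simp
  qed
  finally show ?thesis .
qed

lemma adj_cut_in_T: "kop X (\<lambda>y x. of_bool (lev x = p \<and> lev y = q \<and> card (x \<inter> y) = k - 1)) \<in> T"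
proof -
  have "kop X (\<lambda>y x. of_bool (lev x = p \<and> lev y = q) * of_bool (card (x \<inter> y) = k - 1)) \<in> T"
    by (rule kop_cut_in_T) (use adj_op_in_T in \<open>simp add: adj_op_eq_kop\<close>)
  also have "kop X (\<lambda>y x. of_bool (lev x = p \<and> lev y = q) * of_bool (card (x \<inter> y) = k - 1)) =
      kop X (\<lambda>y x. of_bool (lev x = p \<and> lev y = q \<and> card (x \<inter> y) = k - 1))"
    by (rule kop_cong) auto
  finally show ?thesis .
qed

section \<open>Classes of nested pairs\<close>

lemma cls_zero_up:
  assumes "y \<in> X" "x \<in> X" "p \<le> q"
  shows "cls y x = (p, q, 0, 0) \<longleftrightarrow>
    lev x = p \<and> lev y = q \<and> y \<inter> x0 \<subseteq> x \<inter> x0 \<and> x - x0 \<subseteq> y - x0"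
proof -
  note p = X_props[OF assms(1)] X_props[OF assms(2)]
  show ?thesis
  proof (cases "lev x = p \<and> lev y = q")
    case True
    then have "sdist (y \<inter> x0) (x \<inter> x0) = 0 \<longleftrightarrow> y \<inter> x0 \<subseteq> x \<inter> x0"
      using p assms(3) by (intro sdist_eq_0_iff) auto
    moreover have "sdist (y - x0) (x - x0) = 0 \<longleftrightarrow> x - x0 \<subseteq> y - x0"
      unfolding sdist_commute[of "y - x0"] using p True assms(3)
      by (intro sdist_eq_0_iff) (auto simp: lev_def)
    ultimately show ?thesis
      using True by (simp add: cls_def)
  qed (auto simp: cls_def)
qed

lemma cls_commute: "cls y x = (p, q, i, j) \<longleftrightarrow> cls x y = (q, p, i, j)"
  by (auto simp: cls_def sdist_commute)

lemma cls_zero_down: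
  assumes "y \<in> X" "x \<in> X" "q \<le> p"
  shows "cls y x = (p, q, 0, 0) \<longleftrightarrow>
    lev x = p \<and> lev y = q \<and> x \<inter> x0 \<subseteq> y \<inter> x0 \<and> y - x0 \<subseteq> x - x0"
  unfolding cls_commute[of y] using cls_zero_up[OF assms(2,1,3)] by auto

lemma cls_zero_diag: "y \<in> X \<Longrightarrow> x \<in> X \<Longrightarrow> cls y x = (p, p, 0, 0) \<longleftrightarrow> y = x \<and> lev x = p"
  using cls_zero_up[of y x p p] cls_zero_down[of y x p p] by (auto simp: cls_def sdist_def)

lemma class_zero_step_in_T:
  assumes "q = Suc p \<or> p = Suc q"
  shows "class_op X cls (p, q, 0, 0) \<in> T"
proof -
  have "class_op X cls (p, q, 0, 0) =
      kop X (\<lambda>y x. of_bool (lev x = p \<and> lev y = q \<and> card (x \<inter> y) = k - 1))"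
    unfolding class_op_def
  proof (rule kop_cong)
    fix y x assume "y \<in> X" "x \<in> X"
    have "a = p \<and> b = q \<and> s = 0 \<and> t = 0 \<longleftrightarrow> a = p \<and> b = q \<and>
        (a = b \<and> s + t = 1 \<or> (b = Suc a \<or> a = Suc b) \<and> s = 0 \<and> t = 0)" for a b s t :: nat
      using assms by auto
    then have "cls y x = (p, q, 0, 0) \<longleftrightarrow> lev x = p \<and> lev y = q \<and> card (x \<inter> y) = k - 1"
      unfolding card_Int_eq_iff[OF \<open>x \<in> X\<close> \<open>y \<in> X\<close>] cls_def prod.inject .
    then show "of_bool (cls y x = (p, q, 0, 0)) =
        of_bool (lev x = p \<and> lev y = q \<and> card (x \<inter> y) = k - 1)"
      by simp
  qed
  then show ?thesis
    using adj_cut_in_T by simp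
qed

text \<open>Induction on the difference of the levels: one more step composes nested pairs, and
  inclusions compose to inclusions, so the product is supported on the desired class alone.\<close>

lemma class_zero_in_T: "class_op X cls (p, q, 0, 0) \<in> T"
proof -
  have diag: "class_op X cls (p, p, 0, 0) \<in> T" for p
  proof -
    have "class_op X cls (p, p, 0, 0) = kop X (\<lambda>y x. of_bool (y = x \<and> lev x = p))"
      unfolding class_op_def by (rule kop_cong) (simp add: cls_zero_diag)
    then show ?thesis
      using level_projection_in_T by simp
  qed
  have up: "class_op X cls (p, p + d, 0, 0) \<in> T" for p d
  proof (induction d)
    case 0
    then show ?case
      using diag by simp
  next
    case (Suc d)
    show ?case
    proof (rule class_op_mem_product[OF finite_X T_subalgebra T_subset_class_ops _ Suc])
      show "class_op X cls (p + d, p + Suc d, 0, 0) \<in> T"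
        by (rule class_zero_step_in_T) simp
    next
      fix y x assume m: "y \<in> X" "x \<in> X" "cls y x = (p, p + Suc d, 0, 0)"
      note c = cls_zero_up[OF m(1,2), THEN iffD1, OF _ m(3), simplified]
      note px = X_props[OF m(1)] X_props[OF m(2)]
      \<comment> \<open>The intermediate vertex on level \<open>p + d\<close> is found by
        interpolating both chains of inclusions with sets of the sizes this level
        prescribes.\<close>
      have le: "card (y \<inter> x0) \<le> k - (p + d)" "k - (p + d) \<le> card (x \<inter> x0)"
        "card (x - x0) \<le> p + d" "p + d \<le> card (y - x0)"
        using px(7,16) c by (simp_all add: lev_def)
      obtain A where A: "y \<inter> x0 \<subseteq> A" "A \<subseteq> x \<inter> x0" "card A = k - (p + d)"
        using exists_subset_between[OF le(1,2)] px c by blast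
      obtain B where B: "x - x0 \<subseteq> B" "B \<subseteq> y - x0" "card B = p + d"
        using exists_subset_between[OF le(3,4)] px c by blast
      have AB: "A \<subseteq> x0" "B \<subseteq> \<Omega> - x0" "card A + card B = k"
        using A B px c by auto
      note z = exists_join[OF AB]
      show "\<exists>z\<in>X. cls y z = (p + d, p + Suc d, 0, 0) \<and> cls z x = (p, p + d, 0, 0)"
      proof (rule bexI[of _ "A \<union> B"])
        show "cls y (A \<union> B) = (p + d, p + Suc d, 0, 0) \<and> cls (A \<union> B) x = (p, p + d, 0, 0)"
          using A B c m z by (simp add: cls_zero_up)
      qed (rule z)
    next
      fix y z x assume m: "y \<in> X" "z \<in> X" "x \<in> X" "cls y z = (p + d, p + Suc d, 0, 0)"
        "cls z x = (p, p + d, 0, 0)" "cls y x \<noteq> (p, p + Suc d, 0, 0)"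
      \<comment> \<open>No other class is reached: transitivity of inclusion contradicts the last
        assumption.\<close>
      then show "class_op X cls (cls y x) \<in> T"
        by (auto simp: cls_zero_up)
    qed
  qed
  have down: "class_op X cls (q + d, q, 0, 0) \<in> T" for q d
  proof (induction d)
    case 0
    then show ?case
      using diag by simp
  next
    case (Suc d)
    show ?case
    proof (rule class_op_mem_product[OF finite_X T_subalgebra T_subset_class_ops Suc])
      show "class_op X cls (q + Suc d, q + d, 0, 0) \<in> T"
        by (rule class_zero_step_in_T) simp
    next
      fix y x assume m: "y \<in> X" "x \<in> X" "cls y x = (q + Suc d, q, 0, 0)"
      note c = cls_zero_down[OF m(1,2), THEN iffD1, OF _ m(3), simplified]
      note px = X_props[OF m(1)] X_props[OF m(2)]
      have le: "card (x \<inter> x0) \<le> k - (q + d)" "k - (q + d) \<le> card (y \<inter> x0)"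
        "card (y - x0) \<le> q + d" "q + d \<le> card (x - x0)"
        using px(7,16) c by (simp_all add: lev_def)
      obtain A where A: "x \<inter> x0 \<subseteq> A" "A \<subseteq> y \<inter> x0" "card A = k - (q + d)"
        using exists_subset_between[OF le(1,2)] px c by blast
      obtain B where B: "y - x0 \<subseteq> B" "B \<subseteq> x - x0" "card B = q + d"
        using exists_subset_between[OF le(3,4)] px c by blast
      have AB: "A \<subseteq> x0" "B \<subseteq> \<Omega> - x0" "card A + card B = k"
        using A B px c by auto
      note z = exists_join[OF AB]
      show "\<exists>z\<in>X. cls y z = (q + d, q, 0, 0) \<and> cls z x = (q + Suc d, q + d, 0, 0)"
      proof (rule bexI[of _ "A \<union> B"])
        show "cls y (A \<union> B) = (q + d, q, 0, 0) \<and> cls (A \<union> B) x = (q + Suc d, q + d, 0, 0)"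
          using A B c m z by (simp add: cls_zero_down)
      qed (rule z)
    next
      fix y z x assume m: "y \<in> X" "z \<in> X" "x \<in> X" "cls y z = (q + d, q, 0, 0)"
        "cls z x = (q + Suc d, q + d, 0, 0)" "cls y x \<noteq> (q + Suc d, q, 0, 0)"
      then show "class_op X cls (cls y x) \<in> T"
        by (auto simp: cls_zero_down)
    qed
  qed
  show ?thesis
    using up[of p "q - p"] down[of q "p - q"] by (cases "p \<le> q") auto
qed

section \<open>Exchanges within a level\<close>

text \<open>Since \<open>y\<close> and \<open>z\<close> lie on the same level, their parts inside
  and outside \<open>x0\<close> have equal sizes, as \<open>sdist_triangle\<close> requires.\<close>

lemma cls_triangle:
  assumes "y \<in> X" "z \<in> X" "x \<in> X" "cls y z = (q, q, i, j)" "cls z x = (p, q, i', j')"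
  obtains a b where "cls y x = (p, q, a, b)" "a \<le> i + i'" "b \<le> j + j'"
proof
  note px = X_props[OF assms(1)] X_props[OF assms(2)] X_props[OF assms(3)]
  show "cls y x = (p, q, sdist (y \<inter> x0) (x \<inter> x0), sdist (y - x0) (x - x0))"
    using assms(4,5) by (simp add: cls_def)
  show "sdist (y \<inter> x0) (x \<inter> x0) \<le> i + i'"
    using sdist_triangle[of "y \<inter> x0" "x \<inter> x0" "z \<inter> x0"] px assms(4,5) by (simp add: cls_def)
  show "sdist (y - x0) (x - x0) \<le> j + j'"
    using sdist_triangle[of "y - x0" "x - x0" "z - x0"] px assms(4,5) by (simp add: cls_def lev_def)
qed

text \<open>Each flag asks for one swap that brings the corresponding part of \<open>y\<close> closer to \<open>x\<close>.\<close>

lemma exists_closer: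
  assumes "y \<in> X" "x \<in> X" "cls y x = (p, q, i, j)"
    and "s \<Longrightarrow> 0 < i" "t \<Longrightarrow> 0 < j"
  shows "\<exists>z\<in>X. cls y z = (q, q, of_bool s, of_bool t) \<and>
    cls z x = (p, q, i - of_bool s, j - of_bool t)"
proof -
  note px = X_props[OF assms(1)] X_props[OF assms(2)]
  have ex: "\<exists>C. C \<subseteq> A \<union> B \<and> card C = card A \<and> sdist A C = of_bool s \<and>
      sdist C B = sdist A B - of_bool s"
    if "finite A" "finite B" "s \<Longrightarrow> 0 < sdist A B" for A B :: "'a set" and s
  proof (cases s)
    case True
    then show ?thesis
      using sdist_decrease[OF that(1,2)] that(3) by simp
  next
    case False
    then show ?thesis
      by (intro exI[of _ A]) (simp add: sdist_def)
  qed
  obtain A where A: "A \<subseteq> (y \<inter> x0) \<union> (x \<inter> x0)" "card A = card (y \<inter> x0)"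
    "sdist (y \<inter> x0) A = of_bool s" "sdist A (x \<inter> x0) = sdist (y \<inter> x0) (x \<inter> x0) - of_bool s"
    using ex[of "y \<inter> x0" "x \<inter> x0" s] px assms(3,4) by (auto simp: cls_def)
  obtain B where B: "B \<subseteq> (y - x0) \<union> (x - x0)" "card B = card (y - x0)"
    "sdist (y - x0) B = of_bool t" "sdist B (x - x0) = sdist (y - x0) (x - x0) - of_bool t"
    using ex[of "y - x0" "x - x0" t] px assms(3,5) by (auto simp: cls_def)
  have AB: "A \<subseteq> x0" "B \<subseteq> \<Omega> - x0" "card A + card B = k"
    using A B px by (auto simp: lev_def)
  note z = exists_join[OF AB]
  have "lev (A \<union> B) = lev y"
    using z(4) B by (simp add: lev_def)
  then show ?thesis
    using z A B assms(3) by (intro bexI[of _ "A \<union> B"]) (auto simp: cls_def)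
qed

text \<open>On levels 0 and \<open>k\<close> the part inside \<open>x0\<close> is all of
  \<open>x0\<close> or empty, so nothing can be exchanged there.\<close>

lemma cls_same_level_bounds:
  assumes "y \<in> X" "x \<in> X" "cls y x = (p, p, Suc i, j)"
  shows "0 < p" "p < k"
proof -
  note px = X_props[OF assms(1)] X_props[OF assms(2)]
  have c: "lev x = p" "lev y = p" "sdist (y \<inter> x0) (x \<inter> x0) = Suc i"
    using assms(3) by (auto simp: cls_def)
  have "Suc i \<le> depth (card x0) (card (y \<inter> x0)) (card (x \<inter> x0))"
    unfolding c(3)[symmetric] using x0_props by (intro sdist_le_depth) auto
  then show "0 < p" "p < k"
    using px c x0_props by (auto simp: depth_def)
qed

lemma cls_same_level_cards:
  assumes "y \<in> X" "x \<in> X" "cls y x = (p, p, i, j)"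
  shows "card (y \<inter> x \<inter> x0) + i + p = k" "card ((y \<union> x) \<inter> x0) + p = k + i"
    "card ((y \<inter> x) - x0) + j = p" "card ((y \<union> x) - x0) = p + j"
proof -
  note py = X_props[OF assms(1)] and px = X_props[OF assms(2)]
  have c: "lev x = p" "lev y = p" "sdist (y \<inter> x0) (x \<inter> x0) = i" "sdist (y - x0) (x - x0) = j"
    using assms(3) by (auto simp: cls_def)
  have d: "card (y \<inter> x0 - x \<inter> x0) = i" "card (y - x0 - (x - x0)) = j"
    using sdist_cases(1)[OF py(4) px(4)] sdist_cases(1)[OF py(5) px(5)] c px(7) py(7)
    by (simp_all add: lev_def)
  have I: "y \<inter> x0 \<inter> (x \<inter> x0) = y \<inter> x \<inter> x0" "(y - x0) \<inter> (x - x0) = (y \<inter> x) - x0"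
    "y \<inter> x0 \<union> x \<inter> x0 = (y \<union> x) \<inter> x0" "(y - x0) \<union> (x - x0) = (y \<union> x) - x0"
    by auto
  show 1: "card (y \<inter> x \<inter> x0) + i + p = k"
    using card_Int_Diff[OF py(4), of "x \<inter> x0"] py(6) c(2) unfolding I d by simp
  show 2: "card ((y \<inter> x) - x0) + j = p"
    using card_Int_Diff[OF py(5), of "x - x0"] c(2) unfolding I d lev_def by simp
  show "card ((y \<union> x) \<inter> x0) + p = k + i"
    using card_Un_Int[OF py(4) px(4)] 1 py(6) px(6) c unfolding I by simp
  show "card ((y \<union> x) - x0) = p + j"
    using card_Un_Int[OF py(5) px(5)] 2 c unfolding I lev_def by simp
qed

text \<open>The inner part of \<open>z\<close> is contained in those of \<open>y\<close> and
  \<open>x\<close> and misses one point of each; its outer part contains theirs with one extra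
  point. Hence each of the two parts differs by at most one exchange.\<close>

lemma cls_around_above:
  assumes "y \<in> X" "z \<in> X" "x \<in> X" "cls y z = (Suc p, p, 0, 0)" "cls z x = (p, Suc p, 0, 0)"
  obtains i j where "cls y x = (p, p, i, j)" "i \<le> 1" "j \<le> 1"
proof
  note py = X_props[OF assms(1)] and pz = X_props[OF assms(2)] and px = X_props[OF assms(3)]
  have yz: "lev z = Suc p" "lev y = p" "z \<inter> x0 \<subseteq> y \<inter> x0" "y - x0 \<subseteq> z - x0"
    using assms(4) cls_zero_down[OF assms(1,2)] by auto
  have zx: "lev x = p" "z \<inter> x0 \<subseteq> x \<inter> x0" "x - x0 \<subseteq> z - x0"
    using assms(5) cls_zero_up[OF assms(2,3)] by auto
  show "cls y x = (p, p, sdist (y \<inter> x0) (x \<inter> x0), sdist (y - x0) (x - x0))"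
    using yz zx by (simp add: cls_def)
  have "card (y \<inter> x0 - x \<inter> x0) \<le> card (y \<inter> x0 - z \<inter> x0)"
    using zx py by (intro card_mono) auto
  also have "\<dots> = 1"
    using yz py(6) pz(4,6) by (simp add: card_Diff_subset)
  finally show "sdist (y \<inter> x0) (x \<inter> x0) \<le> 1"
    by (simp add: sdist_def)
  have "card (y - x0 - (x - x0)) \<le> card (z - x0 - (x - x0))"
    using yz pz by (intro card_mono) auto
  also have "\<dots> = card (z - x0) - card (x - x0)"
    using zx px(5) by (intro card_Diff_subset)
  also have "\<dots> = 1"
    using yz(1) zx(1) by (simp add: lev_def)
  finally show "sdist (y - x0) (x - x0) \<le> 1"
    by (simp add: sdist_def)
qed

lemma cls_around_below:
  assumes "y \<in> X" "z \<in> X" "x \<in> X" "cls y z = (p, Suc p, 0, 0)" "cls z x = (Suc p, p, 0, 0)"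
  obtains i j where "cls y x = (Suc p, Suc p, i, j)" "i \<le> 1" "j \<le> 1"
proof
  note py = X_props[OF assms(1)] and pz = X_props[OF assms(2)] and px = X_props[OF assms(3)]
  have yz: "lev z = p" "lev y = Suc p" "y \<inter> x0 \<subseteq> z \<inter> x0" "z - x0 \<subseteq> y - x0"
    using assms(4) cls_zero_up[OF assms(1,2)] by auto
  have zx: "lev x = Suc p" "x \<inter> x0 \<subseteq> z \<inter> x0" "z - x0 \<subseteq> x - x0"
    using assms(5) cls_zero_down[OF assms(2,3)] by auto
  show "cls y x = (Suc p, Suc p, sdist (y \<inter> x0) (x \<inter> x0), sdist (y - x0) (x - x0))"
    using yz zx by (simp add: cls_def)
  have "card (y \<inter> x0 - x \<inter> x0) \<le> card (z \<inter> x0 - x \<inter> x0)"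
    using yz pz by (intro card_mono) auto
  also have "\<dots> = 1"
    using yz zx px(4,6) pz(6) by (simp add: card_Diff_subset)
  finally show "sdist (y \<inter> x0) (x \<inter> x0) \<le> 1"
    by (simp add: sdist_def)
  have "card (y - x0 - (x - x0)) \<le> card (y - x0 - (z - x0))"
    using zx py by (intro card_mono) auto
  also have "\<dots> = card (y - x0) - card (z - x0)"
    using yz pz(5) by (intro card_Diff_subset)
  also have "\<dots> = 1"
    using yz(1,2) by (simp add: lev_def)
  finally show "sdist (y - x0) (x - x0) \<le> 1"
    by (simp add: sdist_def)
qed

text \<open>A vertex on level \<open>m\<close> is an independent choice of its part inside and its
  part outside \<open>x0\<close>.\<close>

lemma card_level_product:
  "card {z \<in> X. lev z = m \<and> P (z \<inter> x0) \<and> R (z - x0)} =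
    card {A. A \<subseteq> x0 \<and> card A + m = k \<and> P A} * card {B. B \<subseteq> \<Omega> - x0 \<and> card B = m \<and> R B}"
proof -
  have "bij_betw (\<lambda>z. (z \<inter> x0, z - x0)) {z \<in> X. lev z = m \<and> P (z \<inter> x0) \<and> R (z - x0)}
      ({A. A \<subseteq> x0 \<and> card A + m = k \<and> P A} \<times> {B. B \<subseteq> \<Omega> - x0 \<and> card B = m \<and> R B})"
  proof (rule bij_betw_byWitness[where f' = "\<lambda>(A, B). A \<union> B"])
    show "(\<lambda>z. (z \<inter> x0, z - x0)) ` {z \<in> X. lev z = m \<and> P (z \<inter> x0) \<and> R (z - x0)} \<subseteq>
        {A. A \<subseteq> x0 \<and> card A + m = k \<and> P A} \<times> {B. B \<subseteq> \<Omega> - x0 \<and> card B = m \<and> R B}"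
    proof (rule image_subsetI)
      fix z assume z: "z \<in> {z \<in> X. lev z = m \<and> P (z \<inter> x0) \<and> R (z - x0)}"
      then show "(z \<inter> x0, z - x0) \<in>
          {A. A \<subseteq> x0 \<and> card A + m = k \<and> P A} \<times> {B. B \<subseteq> \<Omega> - x0 \<and> card B = m \<and> R B}"
        using X_props(1,6)[of z] by (auto simp: lev_def)
    qed
    show "(\<lambda>(A, B). A \<union> B) `
        ({A. A \<subseteq> x0 \<and> card A + m = k \<and> P A} \<times> {B. B \<subseteq> \<Omega> - x0 \<and> card B = m \<and> R B}) \<subseteq>
        {z \<in> X. lev z = m \<and> P (z \<inter> x0) \<and> R (z - x0)}"
    proof (rule image_subsetI)
      fix c
      assume "c \<in> {A. A \<subseteq> x0 \<and> card A + m = k \<and> P A} \<times> {B. B \<subseteq> \<Omega> - x0 \<and> card B = m \<and> R B}"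
      then obtain A B where AB: "c = (A, B)" "A \<subseteq> x0" "B \<subseteq> \<Omega> - x0" "card A + card B = k"
        "P A" "R B" "card B = m"
        by auto
      then show "(case c of (A, B) \<Rightarrow> A \<union> B) \<in> {z \<in> X. lev z = m \<and> P (z \<inter> x0) \<and> R (z - x0)}"
        using exists_join[OF AB(2,3,4)] by simp
    qed
  qed auto
  then show ?thesis
    by (simp add: bij_betw_same_card card_cartesian_product)
qed

text \<open>The inner part of \<open>z\<close> is a subset of the common inner part of
  \<open>y\<close> and \<open>x\<close>, one smaller than either inner part; its outer part is a
  superset of the union of the outer parts with \<open>Suc p\<close> points. The bound on
  \<open>j\<close> keeps \<open>1 - j\<close> from being truncated.\<close>

lemma card_above:
  assumes "y \<in> X" "x \<in> X" "cls y x = (p, p, i, j)" "p < k" "j \<le> 1"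
  shows "card {z \<in> X. cls y z = (Suc p, p, 0, 0) \<and> cls z x = (p, Suc p, 0, 0)} =
    (k - p - i choose (k - Suc p)) * (card \<Omega> - k - (p + j) choose (1 - j))"
proof -
  note c = cls_same_level_cards[OF assms(1-3)]
  have lev: "lev y = p" "lev x = p"
    using assms(3) by (auto simp: cls_def)
  have "{z \<in> X. cls y z = (Suc p, p, 0, 0) \<and> cls z x = (p, Suc p, 0, 0)} =
      {z \<in> X. lev z = Suc p \<and> z \<inter> x0 \<subseteq> y \<inter> x \<inter> x0 \<and> (y \<union> x) - x0 \<subseteq> z - x0}"
    using assms(1,2) lev by (auto simp: cls_zero_up cls_zero_down)
  then have "card {z \<in> X. cls y z = (Suc p, p, 0, 0) \<and> cls z x = (p, Suc p, 0, 0)} =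
      card {A. A \<subseteq> x0 \<and> card A + Suc p = k \<and> A \<subseteq> y \<inter> x \<inter> x0} *
      card {B. B \<subseteq> \<Omega> - x0 \<and> card B = Suc p \<and> (y \<union> x) - x0 \<subseteq> B}"
    by (simp only: card_level_product[where P = "\<lambda>A. A \<subseteq> y \<inter> x \<inter> x0"
      and R = "\<lambda>B. (y \<union> x) - x0 \<subseteq> B"])
  also have "{A. A \<subseteq> x0 \<and> card A + Suc p = k \<and> A \<subseteq> y \<inter> x \<inter> x0} =
      {A. A \<subseteq> y \<inter> x \<inter> x0 \<and> card A = k - Suc p}"
    using assms(4) by auto
  also have "card \<dots> = (k - p - i choose (k - Suc p))"
  proof -
    have "card (y \<inter> x \<inter> x0) = k - p - i"
      using c(1) by simp
    then show ?thesis
      using n_subsets[of "y \<inter> x \<inter> x0" "k - Suc p"] x0_props(2) by simp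
  qed
  also have "{B. B \<subseteq> \<Omega> - x0 \<and> card B = Suc p \<and> (y \<union> x) - x0 \<subseteq> B} =
      {B. (y \<union> x) - x0 \<subseteq> B \<and> B \<subseteq> \<Omega> - x0 \<and> card B = Suc p}"
    by auto
  also have "card \<dots> = (card \<Omega> - k - (p + j) choose (1 - j))"
    using X_props(1)[OF assms(1)] X_props(1)[OF assms(2)] x0_props c(4) assms(5)
    by (subst card_supersets) auto
  finally show ?thesis .
qed

text \<open>The mirror image of \<open>card_above\<close>: now the inner part contains a union and
  the outer part lies in an intersection, so the bound concerns \<open>i\<close>.\<close>

lemma card_below:
  assumes "y \<in> X" "x \<in> X" "cls y x = (Suc p, Suc p, i, j)" "i \<le> 1"
  shows "card {z \<in> X. cls y z = (p, Suc p, 0, 0) \<and> cls z x = (Suc p, p, 0, 0)} =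
    (Suc p - i choose (1 - i)) * (Suc p - j choose p)"
proof -
  note c = cls_same_level_cards[OF assms(1-3)]
  have lev: "lev y = Suc p" "lev x = Suc p"
    using assms(3) by (auto simp: cls_def)
  have "Suc p \<le> k"
    using X_props(8)[OF assms(1)] lev by simp
  have "{z \<in> X. cls y z = (p, Suc p, 0, 0) \<and> cls z x = (Suc p, p, 0, 0)} =
      {z \<in> X. lev z = p \<and> (y \<union> x) \<inter> x0 \<subseteq> z \<inter> x0 \<and> z - x0 \<subseteq> (y \<inter> x) - x0}"
    using assms(1,2) lev by (auto simp: cls_zero_up cls_zero_down)
  then have "card {z \<in> X. cls y z = (p, Suc p, 0, 0) \<and> cls z x = (Suc p, p, 0, 0)} =
      card {A. A \<subseteq> x0 \<and> card A + p = k \<and> (y \<union> x) \<inter> x0 \<subseteq> A} *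
      card {B. B \<subseteq> \<Omega> - x0 \<and> card B = p \<and> B \<subseteq> (y \<inter> x) - x0}"
    by (simp only: card_level_product[where P = "\<lambda>A. (y \<union> x) \<inter> x0 \<subseteq> A"
      and R = "\<lambda>B. B \<subseteq> (y \<inter> x) - x0"])
  also have "{A. A \<subseteq> x0 \<and> card A + p = k \<and> (y \<union> x) \<inter> x0 \<subseteq> A} =
      {A. (y \<union> x) \<inter> x0 \<subseteq> A \<and> A \<subseteq> x0 \<and> card A = k - p}"
    using \<open>Suc p \<le> k\<close> by auto
  also have "card \<dots> = (k - card ((y \<union> x) \<inter> x0) choose (k - p - card ((y \<union> x) \<inter> x0)))"
    using x0_props c(2) assms(4) by (subst card_supersets) auto
  also have "k - card ((y \<union> x) \<inter> x0) = Suc p - i"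
    using c(2) \<open>Suc p \<le> k\<close> by linarith
  also have "k - p - card ((y \<union> x) \<inter> x0) = 1 - i"
    using c(2) \<open>Suc p \<le> k\<close> by linarith
  also have "{B. B \<subseteq> \<Omega> - x0 \<and> card B = p \<and> B \<subseteq> (y \<inter> x) - x0} =
      {B. B \<subseteq> (y \<inter> x) - x0 \<and> card B = p}"
    using X_props(1)[OF assms(1)] by auto
  also have "card \<dots> = (Suc p - j choose p)"
  proof -
    have "card ((y \<inter> x) - x0) = Suc p - j"
      using c(3) by linarith
    then show ?thesis
      using X_props(2)[OF assms(1)] by (simp add: n_subsets)
  qed
  finally show ?thesis .
qed

lemma card_Int_eq_iff_same_level:
  assumes "y \<in> X" "x \<in> X" "cls y x = (p, p, i, j)"
  shows "card (x \<inter> y) = k - 1 \<longleftrightarrow> i + j = 1"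
proof -
  have "lev x = p" "lev y = p" "sdist (y \<inter> x0) (x \<inter> x0) = i" "sdist (y - x0) (x - x0) = j"
    using assms(3) by (auto simp: cls_def)
  then show ?thesis
    using card_Int_eq_iff[OF assms(2,1)] by simp
qed

text \<open>
  Let \<open>J\<^sub>1\<close> and \<open>J\<^sub>2\<close> swap one element inside \<open>x0\<close> and outside \<open>x0\<close>, respectively.
  On level \<open>p\<close>, up to the identity, going up and down again is
  \<open>(D - k - p) J\<^sub>1 + (k - p) J\<^sub>2 + J\<^sub>1 J\<^sub>2\<close>, going down and up again is
  \<open>p J\<^sub>1 + p J\<^sub>2 + J\<^sub>1 J\<^sub>2\<close>, and adjacency is \<open>J\<^sub>1 + J\<^sub>2\<close>. Hence \<open>(D - 2 k) J\<^sub>1\<close> is in the algebra.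
\<close>

lemma class_one_zero_in_T:
  assumes "card \<Omega> \<noteq> 2 * k"
  shows "class_op X cls (p, p, 1, 0) \<in> T"
proof (cases "0 < p \<and> p < k")
  case False
  then have "cls y x \<noteq> (p, p, 1, 0)" if "y \<in> X" "x \<in> X" for y x
    using cls_same_level_bounds[OF that, of p 0 0] by auto
  then have "class_op X cls (p, p, 1, 0) = 0"
    by (rule class_op_eq_zero)
  then show ?thesis
    using oper.subspace_0[OF T_subspace] by simp
next
  case True
  then obtain m where m: "p = Suc m"
    using gr0_implies_Suc by blast
  define U where "U y x = card {z \<in> X. cls y z = (Suc p, p, 0, 0) \<and> cls z x = (p, Suc p, 0, 0)}" for y x
  define L where "L y x = card {z \<in> X. cls y z = (m, p, 0, 0) \<and> cls z x = (p, m, 0, 0)}" for y x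
  define a where "a y x \<longleftrightarrow> lev x = p \<and> lev y = p \<and> card (x \<inter> y) = k - 1" for y x
  \<comment> \<open>\<open>U - L\<close> has coefficient \<open>D - k - 2 p\<close> at the inner
    exchange and \<open>k - 2 p\<close> at the outer one. Adding \<open>2 p - k\<close> times
    adjacency cancels the latter and turns the former into \<open>D - 2 k\<close>.\<close>
  define c :: complex where "c = 2 * of_nat p - of_nat k"
  define M where "M y x = of_nat (U y x) + (-1) * of_nat (L y x) + c * of_bool (a y x)" for y x
  show ?thesis
  proof (rule class_op_mem_triangular[OF finite_X T_subalgebra T_subset_class_ops])
    have "kop X (\<lambda>y x. of_nat (U y x)) \<in> T"
      unfolding U_def class_op_comp[OF finite_X, symmetric] by (intro T_comp class_zero_in_T)
    moreover have "kop X (\<lambda>y x. of_nat (L y x)) \<in> T"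
      unfolding L_def class_op_comp[OF finite_X, symmetric] by (intro T_comp class_zero_in_T)
    moreover have "kop X (\<lambda>y x. of_bool (a y x)) \<in> T"
      unfolding a_def by (rule adj_cut_in_T)
    ultimately show "kop X M \<in> T"
      unfolding M_def kop_add[symmetric] opscale_kop[symmetric]
      by (intro oper.subspace_add[OF T_subspace] oper.subspace_scale[OF T_subspace])
  next
    fix y x assume yx: "y \<in> X" "x \<in> X" and cls: "cls y x = (p, p, 1, 0)"
    have lev: "lev x = p" "lev y = p"
      using cls by (auto simp: cls_def)
    have "U y x = card \<Omega> - k - p"
      unfolding U_def using card_above[OF yx cls] True by simp
    moreover have "L y x = p"
      unfolding L_def m using card_below[OF yx cls[unfolded m]] by simp
    moreover have "a y x"
      unfolding a_def using card_Int_eq_iff_same_level[OF yx cls] lev by simp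
    moreover have "p \<le> card \<Omega> - k"
      using X_props(9)[OF yx(1)] lev by simp
    ultimately have "M y x = of_nat (card \<Omega>) - of_nat (2 * k)"
      using k_less by (simp add: M_def c_def of_nat_diff)
    then show "M y x \<noteq> 0"
      using assms by (metis of_nat_eq_iff right_minus_eq)
  next
    fix y x assume yx: "y \<in> X" "x \<in> X" and nz: "M y x \<noteq> 0" and ne: "cls y x \<noteq> (p, p, 1, 0)"
    have "U y x \<noteq> 0 \<or> L y x \<noteq> 0 \<or> a y x"
      using nz by (auto simp: M_def)
    moreover have "\<exists>i j. cls y x = (p, p, i, j) \<and> i \<le> 1 \<and> j \<le> 1" if nzU: "U y x \<noteq> 0"
    proof -
      obtain z where "z \<in> X" "cls y z = (Suc p, p, 0, 0)" "cls z x = (p, Suc p, 0, 0)"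
        using nzU unfolding U_def by (metis (mono_tags, lifting) card.empty empty_Collect_eq)
      then show ?thesis
        using cls_around_above[OF yx(1) _ yx(2)] by metis
    qed
    moreover have "\<exists>i j. cls y x = (p, p, i, j) \<and> i \<le> 1 \<and> j \<le> 1" if nzL: "L y x \<noteq> 0"
    proof -
      obtain z where "z \<in> X" "cls y z = (m, p, 0, 0)" "cls z x = (p, m, 0, 0)"
        using nzL unfolding L_def by (metis (mono_tags, lifting) card.empty empty_Collect_eq)
      then show ?thesis
        unfolding m using cls_around_below[OF yx(1) _ yx(2)] by metis
    qed
    moreover have "\<exists>i j. cls y x = (p, p, i, j) \<and> i \<le> 1 \<and> j \<le> 1" if a: "a y x"
    proof -
      have *: "cls y x = (p, p, sdist (y \<inter> x0) (x \<inter> x0), sdist (y - x0) (x - x0))"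
        using a by (simp add: a_def cls_def)
      then have "sdist (y \<inter> x0) (x \<inter> x0) + sdist (y - x0) (x - x0) = 1"
        using card_Int_eq_iff_same_level[OF yx *] a by (simp add: a_def)
      then show ?thesis
        using * by auto
    qed
    ultimately obtain i j where cls: "cls y x = (p, p, i, j)" "i \<le> 1" "j \<le> 1"
      by blast
    \<comment> \<open>Of the three remaining classes the identity is available already, and
      \<open>M\<close> vanishes on the other two.\<close>
    consider "i = 0" "j = 0" | "i = 0" "j = 1" | "i = 1" "j = 1"
      using cls ne by force
    then show "class_op X cls (cls y x) \<in> T"
    proof cases
      case 1
      then show ?thesis
        unfolding cls(1) using class_zero_in_T by simp
    next
      case 2
      have lev: "lev x = p" "lev y = p"
        using cls by (auto simp: cls_def)
      have "U y x = k - p"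
        unfolding U_def using card_above[OF yx cls(1)] True binomial_Suc_n[of "k - Suc p"] 2
        by (simp add: Suc_diff_Suc)
      moreover have "L y x = p"
        unfolding L_def m using card_below[OF yx cls(1)[unfolded m]] 2 by simp
      moreover have "a y x"
        unfolding a_def using card_Int_eq_iff_same_level[OF yx cls(1)] lev 2 by simp
      ultimately have "M y x = 0"
        using True by (simp add: M_def c_def of_nat_diff)
      then show ?thesis
        using nz by simp
    next
      case 3
      have "U y x = 1"
        unfolding U_def using card_above[OF yx cls(1)] True 3 by simp
      moreover have "L y x = 1"
        unfolding L_def m using card_below[OF yx cls(1)[unfolded m]] 3 by simp
      moreover have "\<not> a y x"
        unfolding a_def using card_Int_eq_iff_same_level[OF yx cls(1)] 3 by simp
      ultimately have "M y x = 0"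
        by (simp add: M_def)
      then show ?thesis
        using nz by simp
    qed
  qed
qed

text \<open>Adjacency within a level is the sum of the inner and the outer exchange, and the inner
  one is available by \<open>class_one_zero_in_T\<close>.\<close>

lemma class_zero_one_in_T:
  assumes "card \<Omega> \<noteq> 2 * k"
  shows "class_op X cls (p, p, 0, 1) \<in> T"
proof (rule class_op_mem_triangular[OF finite_X T_subalgebra T_subset_class_ops adj_cut_in_T])
  fix y x assume yx: "y \<in> X" "x \<in> X"
  show "of_bool (lev x = p \<and> lev y = p \<and> card (x \<inter> y) = k - 1) \<noteq> (0::complex)"
    if cls: "cls y x = (p, p, 0, 1)"
    using card_Int_eq_iff_same_level[OF yx cls] cls by (simp add: cls_def)
  show "class_op X cls (cls y x) \<in> T"
    if "of_bool (lev x = p \<and> lev y = p \<and> card (x \<inter> y) = k - 1) \<noteq> (0::complex)"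
      "cls y x \<noteq> (p, p, 0, 1)"
  proof -
    have a: "lev x = p" "lev y = p" "card (x \<inter> y) = k - 1"
      using that(1) by auto
    have *: "cls y x = (p, p, sdist (y \<inter> x0) (x \<inter> x0), sdist (y - x0) (x - x0))"
      using a by (simp add: cls_def)
    then have "sdist (y \<inter> x0) (x \<inter> x0) + sdist (y - x0) (x - x0) = 1"
      using card_Int_eq_iff_same_level[OF yx *] a by simp
    then have "cls y x = (p, p, 1, 0)"
      using * that(2) by (cases "sdist (y \<inter> x0) (x \<inter> x0)") auto
    then show ?thesis
      using class_one_zero_in_T[OF assms] by simp
  qed
qed

text \<open>Multiply a class with one exchange fewer by a single exchange on the same side. By the
  triangle inequality every class reached has both numbers bounded by \<open>i\<close> and
  \<open>j\<close>, so all but the desired one have a smaller sum.\<close>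

lemma class_op_in_T:
  assumes "card \<Omega> \<noteq> 2 * k"
  shows "class_op X cls (p, q, i, j) \<in> T"
proof (induction "i + j" arbitrary: i j rule: less_induct)
  case less
  have step: ?case if st: "s \<Longrightarrow> 0 < i" "t \<Longrightarrow> 0 < j" "s \<noteq> t"
    and mem: "class_op X cls (q, q, of_bool s, of_bool t) \<in> T" for s t
  proof (rule class_op_mem_product[OF finite_X T_subalgebra T_subset_class_ops mem])
    show "class_op X cls (p, q, i - of_bool s, j - of_bool t) \<in> T"
      using st by (intro less) auto
  next
    fix y x assume "y \<in> X" "x \<in> X" "cls y x = (p, q, i, j)"
    then show "\<exists>z\<in>X. cls y z = (q, q, of_bool s, of_bool t) \<and>
        cls z x = (p, q, i - of_bool s, j - of_bool t)"
      using st by (intro exists_closer)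
  next
    fix y z x assume m: "y \<in> X" "z \<in> X" "x \<in> X" "cls y z = (q, q, of_bool s, of_bool t)"
      "cls z x = (p, q, i - of_bool s, j - of_bool t)" and ne: "cls y x \<noteq> (p, q, i, j)"
    obtain a b where ab: "cls y x = (p, q, a, b)" "a \<le> of_bool s + (i - of_bool s)"
      "b \<le> of_bool t + (j - of_bool t)"
      using cls_triangle[OF m] by metis
    then have "a \<le> i" "b \<le> j"
      using st by (auto split: if_splits)
    moreover have "a \<noteq> i \<or> b \<noteq> j"
      using ne ab(1) by simp
    ultimately have "a + b < i + j"
      by linarith
    then show "class_op X cls (cls y x) \<in> T"
      unfolding ab(1) by (rule less)
  qed
  consider "i = 0" "j = 0" | "0 < i" | "0 < j"
    by auto
  then show ?case
  proof cases
    case 1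
    then show ?thesis
      using class_zero_in_T by simp
  next
    case 2
    then show ?thesis
      using step[of True False] class_one_zero_in_T[OF assms] by simp
  next
    case 3
    then show ?thesis
      using step[of False True] class_zero_one_in_T[OF assms] by simp
  qed
qed

lemma T_eq_class_ops:
  assumes "card \<Omega> \<noteq> 2 * k"
  shows "T = class_ops X cls"
proof
  show "class_ops X cls \<subseteq> T"
    by (rule class_ops_subsetI[OF finite_X T_subalgebra]) (metis class_op_in_T[OF assms] prod.collapse)
qed (rule T_subset_class_ops)

section \<open>The symmetrized algebra for D = 2 k\<close>

lemma sclsE:
  assumes "scls y x = (p, q, i, j)"
  obtains a b where "cls y x = (p, q, a, b)" "i = min a b" "j = max a b"
  using assms by (auto simp: scls_def split: prod.splits)

lemma scls_eqI: "cls y x = (p, q, a, b) \<Longrightarrow> scls y x = (p, q, min a b, max a b)"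
  by (simp add: scls_def)

lemma scls_zero_iff: "scls y x = (p, q, 0, 0) \<longleftrightarrow> cls y x = (p, q, 0, 0)"
  by (auto simp: scls_def split: prod.splits)

lemma sym_class_zero_in_T: "class_op X scls (p, q, 0, 0) \<in> T"
  using class_zero_in_T[of p q] by (simp add: class_op_def scls_zero_iff)

lemma sym_class_zero_one_in_T: "class_op X scls (p, p, 0, 1) \<in> T"
proof -
  have "class_op X scls (p, p, 0, 1) =
      kop X (\<lambda>y x. of_bool (lev x = p \<and> lev y = p \<and> card (x \<inter> y) = k - 1))"
    unfolding class_op_def
  proof (rule kop_cong)
    fix y x assume yx: "y \<in> X" "x \<in> X"
    have "scls y x = (p, p, 0, 1) \<longleftrightarrow> lev x = p \<and> lev y = p \<and> card (x \<inter> y) = k - 1"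
    proof (cases "lev x = p \<and> lev y = p")
      case True
      define s t where "s = sdist (y \<inter> x0) (x \<inter> x0)" and "t = sdist (y - x0) (x - x0)"
      have cls: "cls y x = (p, p, s, t)"
        using True by (simp add: cls_def s_def t_def)
      have "min s t = 0 \<and> max s t = 1 \<longleftrightarrow> s + t = 1"
        by (auto simp: min_def max_def)
      then show ?thesis
        using True card_Int_eq_iff_same_level[OF yx cls] scls_eqI[OF cls] by simp
    next
      case False
      then show ?thesis
        by (auto simp: scls_def cls_def)
    qed
    then show "of_bool (scls y x = (p, p, 0, 1)) =
        of_bool (lev x = p \<and> lev y = p \<and> card (x \<inter> y) = k - 1)"
      by simp
  qed
  then show ?thesis
    using adj_cut_in_T by simp
qed

text \<open>Going down one level and up again reaches only pairs with at most one exchange on each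
  side; the labels other than \<open>(1, 1)\<close> among these are known. Level 0 has no level
  below it, but also no inner exchange.\<close>

lemma sym_class_one_one_in_T:
  assumes "card \<Omega> = 2 * k"
  shows "class_op X scls (p, p, 1, 1) \<in> T"
proof (cases p)
  case 0
  have "scls y x \<noteq> (p, p, 1, 1)" if "y \<in> X" "x \<in> X" for y x
    using cls_same_level_bounds(1)[OF that, of p 0 1] 0 by (auto elim!: sclsE simp: min_def max_def split: if_splits)
  then have "class_op X scls (p, p, 1, 1) = 0"
    by (rule class_op_eq_zero)
  then show ?thesis
    using oper.subspace_0[OF T_subspace] by simp
next
  case (Suc m)
  show ?thesis
  proof (rule class_op_mem_product[OF finite_X T_subalgebra T_subset_sym_class_ops[OF assms]
      sym_class_zero_in_T sym_class_zero_in_T])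
    fix y x assume yx: "y \<in> X" "x \<in> X" and scls: "scls y x = (p, p, 1, 1)"
    then have cls: "cls y x = (Suc m, Suc m, 1, 1)"
      using Suc by (auto elim!: sclsE simp: min_def max_def split: if_splits)
    have "card {z \<in> X. cls y z = (m, p, 0, 0) \<and> cls z x = (p, m, 0, 0)} = 1"
      using card_below[OF yx cls] Suc by simp
    then have "{z \<in> X. cls y z = (m, p, 0, 0) \<and> cls z x = (p, m, 0, 0)} \<noteq> {}"
      by force
    then show "\<exists>z\<in>X. scls y z = (m, p, 0, 0) \<and> scls z x = (p, m, 0, 0)"
      unfolding scls_zero_iff by blast
  next
    fix y z x assume m: "y \<in> X" "z \<in> X" "x \<in> X" "scls y z = (m, p, 0, 0)" "scls z x = (p, m, 0, 0)"
      and ne: "scls y x \<noteq> (p, p, 1, 1)"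
    obtain i j where ij: "cls y x = (p, p, i, j)" "i \<le> 1" "j \<le> 1"
      using cls_around_below[OF m(1-3)] m(4,5) unfolding scls_zero_iff Suc by metis
    then have "scls y x = (p, p, 0, 0) \<or> scls y x = (p, p, 0, 1)"
      using ne scls_eqI[OF ij(1)] by (cases i; cases j) auto
    then show "class_op X scls (scls y x) \<in> T"
      using sym_class_zero_in_T sym_class_zero_one_in_T by auto
  qed
qed

text \<open>
  Only \<open>J\<^sub>1 + J\<^sub>2\<close> and \<open>J\<^sub>1 J\<^sub>2\<close> are available here; among the classes with a given \<open>i + j\<close>,
  the product reaches those with \<open>0 < i\<close>, after which the sum reaches the remaining one.
\<close>

lemma sym_class_op_in_T:
  assumes D: "card \<Omega> = 2 * k"
  shows "class_op X scls (p, q, i, j) \<in> T"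
proof (induction "i + j" arbitrary: i j rule: less_induct)
  case less
  \<comment> \<open>The exchange numbers in a symmetrized label are sorted, so an unsorted label has
    an empty class.\<close>
  have unrealized: "class_op X scls (p, q, i, j) \<in> T" if "j < i" for i j
  proof -
    have "class_op X scls (p, q, i, j) = 0"
      by (rule class_op_eq_zero) (use that in \<open>auto elim!: sclsE\<close>)
    then show ?thesis
      using oper.subspace_0[OF T_subspace] by simp
  qed
  \<comment> \<open>Proved for all splittings of the same total with positive smaller part, since
    the remaining case \<open>i = 0\<close> refers to these classes without lowering the
    total.\<close>
  have pos: "class_op X scls (p, q, i', j') \<in> T" if ij: "i' + j' = i + j" "0 < i'" for i' j'
  proof (cases "i' \<le> j'")
    case False
    then show ?thesis
      using unrealized by simp
  next
    case True
    show ?thesis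
    proof (rule class_op_mem_product[OF finite_X T_subalgebra T_subset_sym_class_ops[OF D]
        sym_class_one_one_in_T[OF D]])
      show "class_op X scls (p, q, i' - 1, j' - 1) \<in> T"
        using ij True by (intro less) auto
    next
      fix y x assume yx: "y \<in> X" "x \<in> X" and "scls y x = (p, q, i', j')"
      then obtain a b where ab: "cls y x = (p, q, a, b)" "i' = min a b" "j' = max a b"
        by (meson sclsE)
      obtain z where z: "z \<in> X" "cls y z = (q, q, 1, 1)" "cls z x = (p, q, a - 1, b - 1)"
        using exists_closer[OF yx ab(1), of True True] ab(2) ij(2) by auto
      then show "\<exists>z\<in>X. scls y z = (q, q, 1, 1) \<and> scls z x = (p, q, i' - 1, j' - 1)"
        using scls_eqI[OF z(2)] scls_eqI[OF z(3)] ab(2,3)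
        by (intro bexI[of _ z]) (auto simp: min_def max_def)
    next
      fix y z x assume m: "y \<in> X" "z \<in> X" "x \<in> X" "scls y z = (q, q, 1, 1)"
        "scls z x = (p, q, i' - 1, j' - 1)" and ne: "scls y x \<noteq> (p, q, i', j')"
      obtain a b where ab: "cls z x = (p, q, a, b)" "i' - 1 = min a b" "j' - 1 = max a b"
        using m(5) by (rule sclsE)
      have yz: "cls y z = (q, q, 1, 1)"
        using m(4) by (auto elim!: sclsE simp: min_def max_def split: if_splits)
      obtain c d where cd: "cls y x = (p, q, c, d)" "c \<le> 1 + a" "d \<le> 1 + b"
        using cls_triangle[OF m(1-3) yz ab(1)] by metis
      have s: "a + b = i' - 1 + (j' - 1)"
        using ab(2,3) by (auto simp: min_def max_def)
      \<comment> \<open>Equality would force equality in both triangle inequalities, which yields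
        the excluded label. All other classes have a smaller total.\<close>
      have "c + d \<noteq> i' + j'"
      proof
        assume "c + d = i' + j'"
        then have "c = 1 + a" "d = 1 + b"
          using cd(2,3) s ij True by linarith+
        then have "scls y x = (p, q, i', j')"
          using scls_eqI[OF cd(1)] ab(2,3) ij True by (auto simp: min_def max_def split: if_splits)
        then show False
          using ne by simp
      qed
      then have "c + d < i + j"
        using cd(2,3) s ij True by linarith
      then show "class_op X scls (scls y x) \<in> T"
        unfolding scls_eqI[OF cd(1)] by (intro less) (auto simp: min_def max_def)
    qed
  qed
  consider "0 < i" | "i = 0" "j = 0" | "i = 0" "0 < j"
    by auto
  then show ?case
  proof cases
    case 1
    then show ?thesis
      using pos by simp
  next
    case 2
    then show ?thesis
      using sym_class_zero_in_T by simp
  next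
    case 3
    show ?thesis
    proof (rule class_op_mem_product[OF finite_X T_subalgebra T_subset_sym_class_ops[OF D]
        sym_class_zero_one_in_T])
      show "class_op X scls (p, q, 0, j - 1) \<in> T"
        using 3 by (intro less) auto
    next
      fix y x assume yx: "y \<in> X" "x \<in> X" and "scls y x = (p, q, i, j)"
      then obtain a b where ab: "cls y x = (p, q, a, b)" "i = min a b" "j = max a b"
        by (meson sclsE)
      \<comment> \<open>Exactly one of \<open>a\<close> and \<open>b\<close> is positive; the single
        exchange is made on that side.\<close>
      define s t where "s \<longleftrightarrow> 0 < a" and "t \<longleftrightarrow> 0 < b"
      have st: "s \<longleftrightarrow> \<not> t"
        using 3 ab(2,3) by (auto simp: s_def t_def min_def max_def split: if_splits)
      obtain z where z: "z \<in> X" "cls y z = (q, q, of_bool s, of_bool t)"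
        "cls z x = (p, q, a - of_bool s, b - of_bool t)"
        using exists_closer[OF yx ab(1), of s t] by (auto simp: s_def t_def)
      have "scls y z = (q, q, 0, 1)"
        using scls_eqI[OF z(2)] st by (cases t) auto
      moreover have "scls z x = (p, q, 0, j - 1)"
        using scls_eqI[OF z(3)] st 3 ab(2,3) by (cases t) (auto simp: s_def t_def)
      ultimately show "\<exists>z\<in>X. scls y z = (q, q, 0, 1) \<and> scls z x = (p, q, 0, j - 1)"
        using z(1) by blast
    next
      fix y z x assume m: "y \<in> X" "z \<in> X" "x \<in> X" "scls y z = (q, q, 0, 1)"
        "scls z x = (p, q, 0, j - 1)" and ne: "scls y x \<noteq> (p, q, i, j)"
      obtain a b where ab: "cls z x = (p, q, a, b)" "0 = min a b" "j - 1 = max a b"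
        using m(5) by (rule sclsE)
      obtain s t where st: "cls y z = (q, q, s, t)" "0 = min s t" "1 = max s t"
        using m(4) by (rule sclsE)
      obtain c d where cd: "cls y x = (p, q, c, d)" "c \<le> s + a" "d \<le> t + b"
        using cls_triangle[OF m(1-3) st(1) ab(1)] by metis
      have "a + b = j - 1" "s + t = 1"
        using ab(2,3) st(2,3) by (auto simp: min_def max_def split: if_splits)
      then have le: "min c d + max c d \<le> i + j"
        using cd(2,3) 3 by (auto simp: min_def max_def)
      show "class_op X scls (scls y x) \<in> T"
      \<comment> \<open>A class with the full total that is not the desired one has positive
        minimum, so \<open>pos\<close> applies; otherwise the total is smaller and the induction
        hypothesis applies.\<close>
      proof (cases "min c d + max c d = i + j")
        case True
        then have "0 < min c d"
          using ne scls_eqI[OF cd(1)] 3 by (cases "min c d") auto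
        then show ?thesis
          unfolding scls_eqI[OF cd(1)] using True by (intro pos)
      next
        case False
        then show ?thesis
          unfolding scls_eqI[OF cd(1)] using le by (intro less) simp
      qed
    qed
  qed
qed

lemma T_eq_sym_class_ops:
  assumes "card \<Omega> = 2 * k"
  shows "T = class_ops X scls"
proof
  show "class_ops X scls \<subseteq> T"
    by (rule class_ops_subsetI[OF finite_X T_subalgebra]) (metis sym_class_op_in_T[OF assms] prod.collapse)
qed (rule T_subset_sym_class_ops[OF assms])

section \<open>Realized classes and the dimension\<close>

text \<open>Pairs inside and outside \<open>x0\<close> can be prescribed independently. Inside
  \<open>x0\<close> the sizes are \<open>k - p\<close> and \<open>k - q\<close>, but
  \<open>depth\<close> is invariant under this reflection.\<close>

lemma image_cls:
  defines "n \<equiv> min k (card \<Omega> - k)"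
  shows "(\<lambda>(y, x). cls y x) ` (X \<times> X) =
    (SIGMA p:{..n}. SIGMA q:{..n}. {..depth k p q} \<times> {..depth (card \<Omega> - k) p q})"
proof (intro equalityI subsetI)
  fix c assume "c \<in> (\<lambda>(y, x). cls y x) ` (X \<times> X)"
  then obtain y x where yx: "y \<in> X" "x \<in> X" "c = cls y x"
    by auto
  note py = X_props[OF yx(1)] and px = X_props[OF yx(2)]
  have "sdist (y \<inter> x0) (x \<inter> x0) \<le> depth (card x0) (card (y \<inter> x0)) (card (x \<inter> x0))"
    using x0_props by (intro sdist_le_depth) auto
  also have "\<dots> = depth k (lev x) (lev y)"
    unfolding x0_props(3) px(7) py(7) using px(8) py(8) by (simp add: depth_reflect) (simp add: depth_def min.commute)
  finally have 1: "sdist (y \<inter> x0) (x \<inter> x0) \<le> depth k (lev x) (lev y)" .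
  have "sdist (y - x0) (x - x0) \<le> depth (card (\<Omega> - x0)) (card (y - x0)) (card (x - x0))"
    using x0_props px(1) py(1) by (intro sdist_le_depth) auto
  also have "\<dots> = depth (card \<Omega> - k) (lev x) (lev y)"
    unfolding x0_props(5) by (simp add: depth_def min.commute lev_def)
  finally show "c \<in> (SIGMA p:{..n}. SIGMA q:{..n}. {..depth k p q} \<times> {..depth (card \<Omega> - k) p q})"
    using 1 px(8,9) py(8,9) yx(3) by (simp add: cls_def n_def)
next
  fix c assume "c \<in> (SIGMA p:{..n}. SIGMA q:{..n}. {..depth k p q} \<times> {..depth (card \<Omega> - k) p q})"
  then obtain p q i j where c: "c = (p, q, i, j)" "p \<le> n" "q \<le> n" "i \<le> depth k p q"
    "j \<le> depth (card \<Omega> - k) p q"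
    by auto
  have le: "p \<le> k" "q \<le> k" "p \<le> card \<Omega> - k" "q \<le> card \<Omega> - k"
    using c by (auto simp: n_def)
  have "i \<le> depth (card x0) (k - q) (k - p)"
    using c le x0_props by (simp add: depth_reflect) (simp add: depth_def min.commute)
  then obtain A A' where A: "A \<subseteq> x0" "A' \<subseteq> x0" "card A = k - q" "card A' = k - p" "sdist A A' = i"
    using exists_pair_sdist[of x0 "k - q" "k - p" i] x0_props by auto
  have "j \<le> depth (card (\<Omega> - x0)) q p"
    unfolding x0_props(5) using c by (simp add: depth_def min.commute)
  then obtain B B' where B: "B \<subseteq> \<Omega> - x0" "B' \<subseteq> \<Omega> - x0" "card B = q" "card B' = p" "sdist B B' = j"
    using exists_pair_sdist[of "\<Omega> - x0" q p j] x0_props le by metis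
  have k: "card A + card B = k" "card A' + card B' = k"
    using A B le by auto
  note y = exists_join[OF A(1) B(1) k(1)] and x = exists_join[OF A(2) B(2) k(2)]
  have "cls (A \<union> B) (A' \<union> B') = c"
    using y x A B c by (simp add: cls_def)
  then show "c \<in> (\<lambda>(y, x). cls y x) ` (X \<times> X)"
    using y(1) x(1) by (intro image_eqI[of _ _ "(A \<union> B, A' \<union> B')"]) auto
qed

lemma dim_T:
  assumes "card \<Omega> \<noteq> 2 * k"
  shows "oper.dim T = class_count (min k (card \<Omega> - k)) (max k (card \<Omega> - k))"
proof -
  have "oper.dim T = (\<Sum>p\<le>min k (card \<Omega> - k). \<Sum>q\<le>min k (card \<Omega> - k).
      Suc (depth k p q) * Suc (depth (card \<Omega> - k) p q))"
    unfolding T_eq_class_ops[OF assms] dim_class_ops[OF finite_X] image_cls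
    by (simp add: card_SigmaI del: mult_Suc mult_Suc_right)
  then show ?thesis
    unfolding class_count_def by (cases "k \<le> card \<Omega> - k") (simp_all add: min_def max_def mult.commute del: mult_Suc mult_Suc_right)
qed

lemma dim_T_sym:
  assumes D: "card \<Omega> = 2 * k"
  shows "oper.dim T = sym_class_count k"
proof -
  have "card \<Omega> - k = k"
    using D by simp
  have scls: "(\<lambda>(y, x). scls y x) ` (X \<times> X) =
      (\<lambda>(p, q, i, j). (p, q, min i j, max i j)) ` (\<lambda>(y, x). cls y x) ` (X \<times> X)"
    unfolding image_image by (rule image_cong) (auto simp: scls_def)
  also have "\<dots> = (SIGMA p:{..k}. SIGMA q:{..k}. {(i, j). i \<le> j \<and> j \<le> depth k p q})"
    unfolding image_cls \<open>card \<Omega> - k = k\<close> min.idem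
  proof (intro equalityI subsetI)
    fix c assume "c \<in> (SIGMA p:{..k}. SIGMA q:{..k}. {(i, j). i \<le> j \<and> j \<le> depth k p q})"
    then obtain p q i j where "c = (p, q, i, j)" "p \<le> k" "q \<le> k" "i \<le> j" "j \<le> depth k p q"
      by auto
    then show "c \<in> (\<lambda>(p, q, i, j). (p, q, min i j, max i j)) `
        (SIGMA p:{..k}. SIGMA q:{..k}. {..depth k p q} \<times> {..depth k p q})"
      by (intro image_eqI[of _ _ "(p, q, i, j)"]) auto
  qed auto
  finally have img: "(\<lambda>(y, x). scls y x) ` (X \<times> X) =
      (SIGMA p:{..k}. SIGMA q:{..k}. {(i, j). i \<le> j \<and> j \<le> depth k p q})" .
  have tri: "finite {(i, j). i \<le> j \<and> j \<le> r}" "card {(i, j). i \<le> j \<and> j \<le> r} = (\<Sum>i\<le>r. Suc i)"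
    \<comment> \<open>The sorted pairs are counted by their larger entry: there are
      \<open>Suc i\<close> of them with larger entry \<open>i\<close>.\<close>
    for r :: nat
  proof -
    have *: "{(i, j). i \<le> j \<and> j \<le> r} = prod.swap ` (SIGMA j:{..r}. {..j})"
      by (auto simp: image_iff)
    show "finite {(i, j). i \<le> j \<and> j \<le> r}"
      unfolding * by simp
    show "card {(i, j). i \<le> j \<and> j \<le> r} = (\<Sum>i\<le>r. Suc i)"
      unfolding * by (subst card_image) (auto simp: card_SigmaI)
  qed
  show ?thesis
    unfolding T_eq_sym_class_ops[OF D] dim_class_ops[OF finite_X] img sym_class_count_def
    by (simp add: card_SigmaI tri)
qed

end

theorem theorem6p9:
  fixes \<Omega> :: "'a set" and D k :: nat and x0 :: "'a set"
  assumes "finite \<Omega>" and "card \<Omega> = D" and "D \<ge> 2"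
    and "1 \<le> k" and "k \<le> D - 1"
    and "x0 \<in> nsets \<Omega> k"
  shows
    "(real k < real D / 3 \<longrightarrow>
        int (oper.dim (terwilliger_algebra \<Omega> k x0)) =
          int ((k + 3) choose 4) + Q (k + 4)) \<and>
     (real D / 3 \<le> real k \<and> real k < real D / 2 \<longrightarrow>
        int (oper.dim (terwilliger_algebra \<Omega> k x0)) =
          int ((k + 3) choose 4) + Q (k + 4) - Q (3 * k - D + 3)) \<and>
     (real k = real D / 2 \<longrightarrow>
        int (oper.dim (terwilliger_algebra \<Omega> k x0)) = Q (D div 2 + 4)) \<and>
     (real D / 2 < real k \<and> real k \<le> 2 * real D / 3 \<longrightarrow>
        int (oper.dim (terwilliger_algebra \<Omega> k x0)) =
          int ((D - k + 3) choose 4) + Q (D - k + 4) - Q (2 * D - 3 * k + 3)) \<and>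
     (2 * real D / 3 < real k \<longrightarrow>
        int (oper.dim (terwilliger_algebra \<Omega> k x0)) =
          int ((D - k + 3) choose 4) + Q (D - k + 4))"
proof -
  interpret johnson \<Omega> k x0
    by unfold_locales (use assms in auto)
  \<comment> \<open>Here \<open>k\<close> is the smaller parameter, and the threshold
    \<open>m <= 2 * n\<close> in \<open>class_count_formula\<close> becomes
    \<open>D <= 3 * k\<close>.\<close>
  have low: "int (oper.dim T) = int (k + 3 choose 4) + Q (k + 4) -
      (if D \<le> 3 * k then Q (3 * k - D + 3) else 0)" if "2 * k < D"
  proof -
    have eq: "min k (D - k) = k" "max k (D - k) = D - k" "D - k \<le> 2 * k \<longleftrightarrow> D \<le> 3 * k"
      "2 * k - (D - k) = 3 * k - D"
      using that by auto
    show ?thesis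
      using dim_T class_count_formula[of k "D - k"] that assms(2) unfolding eq by (simp add: eq)
  qed
  \<comment> \<open>The roles of \<open>k\<close> and \<open>D - k\<close> are exchanged, so the
    threshold becomes \<open>3 * k <= 2 * D\<close>.\<close>
  have high: "int (oper.dim T) = int (D - k + 3 choose 4) + Q (D - k + 4) -
      (if 3 * k \<le> 2 * D then Q (2 * D - 3 * k + 3) else 0)" if "D < 2 * k"
  proof -
    have eq: "min k (D - k) = D - k" "max k (D - k) = k" "k \<le> 2 * (D - k) \<longleftrightarrow> 3 * k \<le> 2 * D"
      "2 * (D - k) - k = 2 * D - 3 * k" "D - k < k"
      using that assms by auto
    show ?thesis
      using dim_T class_count_formula[of "D - k" k] that assms(2) unfolding eq by (simp add: eq)
  qed
  have middle: "int (oper.dim T) = Q (D div 2 + 4)" if "D = 2 * k"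
    using dim_T_sym that assms(2) by (simp add: Q_eq_sym_class_count)
  show ?thesis
  proof (intro conjI impI)
    assume "real k < real D / 3"
    then have "2 * k < D" "\<not> D \<le> 3 * k"
      by linarith+
    then show "int (oper.dim T) = int (k + 3 choose 4) + Q (k + 4)"
      using low by simp
  next
    assume "real D / 3 \<le> real k \<and> real k < real D / 2"
    then have "2 * k < D" "D \<le> 3 * k"
      by linarith+
    then show "int (oper.dim T) = int (k + 3 choose 4) + Q (k + 4) - Q (3 * k - D + 3)"
      using low by simp
  next
    assume "real k = real D / 2"
    then have "D = 2 * k"
      by linarith
    then show "int (oper.dim T) = Q (D div 2 + 4)"
      by (rule middle)
  next
    assume "real D / 2 < real k \<and> real k \<le> 2 * real D / 3"
    then have "D < 2 * k" "3 * k \<le> 2 * D"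
      by linarith+
    then show "int (oper.dim T) = int (D - k + 3 choose 4) + Q (D - k + 4) - Q (2 * D - 3 * k + 3)"
      using high by simp
  next
    assume "2 * real D / 3 < real k"
    then have "D < 2 * k" "\<not> 3 * k \<le> 2 * D"
      by linarith+
    then show "int (oper.dim T) = int (D - k + 3 choose 4) + Q (D - k + 4)"
      using high by simp
  qed
qed

end
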